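(* Let $p\neq2$ be a prime. For all $n\geq1$ one has $$v_p\bigl(L_p(1+p^{n-1}(p-1),\overline\omega_p^{\,p^{n-1}(p-1)})\bigr)=v_p\bigl(\zeta_p(1+p^{n-1}(p-1))\bigr)=-n.$$ Moreover for all integers $m\geq1$, $$v_p\bigl(L_p(1+2m,\overline\omega_p^{2m})\bigr)\geq\begin{cases}0&\text{if }2m\leq p-2,\\-n&\text{if }p^{n-1}(p-1)\leq2m<p^n(p-1),\ n\geq1.\end{cases}$$
   Context: $v_p$ is the $p$-adic valuation with $v_p(p)=1$. $\overline\omega_p$ is the inverse of the Teichmüller character $\omega_p$ mod $p$; $L_p(s,\chi)$ is the Kubota–Leopoldt $p$-adic $L$-function of the Dirichlet character $\chi$ (standard normalization: $L_p(1-k,\chi)=-(1-\chi\omega_p^{-k}(p)p^{k-1})B_{k,\chi\omega_p^{-k}}/k$ for integers $k\ge1$); $\zeta_p(s)=L_p(s,\mathbf 1)$ is the $p$-adic zeta function. *)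

theory Defs
  imports "HOL-Analysis.Analysis" "Berlekamp_Zassenhaus.Finite_Field"
begin

section \<open>The p-adic absolute value on the rationals\<close>

definition rat_padic_norm :: "nat \<Rightarrow> rat \<Rightarrow> real" where
  "rat_padic_norm p r =
     (if r = 0 then 0
      else real p powi (int (multiplicity (int p) (snd (quotient_of r)))
                      - int (multiplicity (int p) (fst (quotient_of r)))))"

lemma rat_padic_norm_0 [simp]: "rat_padic_norm p 0 = 0"
  by (simp add: rat_padic_norm_def)

lemma rat_padic_norm_frac:
  assumes p: "prime p" and ab: "a \<noteq> 0" "b \<noteq> 0"
  shows "rat_padic_norm p (of_int a / of_int b)
       = real p powi (int (multiplicity (int p) b) - int (multiplicity (int p) a))"
proof -
  obtain c d where cd: "quotient_of (of_int a / of_int b) = (c, d)"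
    by (cases "quotient_of (of_int a / of_int b)")
  have d: "d > 0" and eq: "(of_int a / of_int b :: rat) = of_int c / of_int d"
    using cd quotient_of_denom_pos quotient_of_div by blast+
  have c: "c \<noteq> 0"
    using eq ab d by auto
  have "(of_int (a * d) :: rat) = of_int (c * b)"
    using eq ab d by (simp add: field_simps)
  then have "a * d = c * b"
    using of_int_eq_iff by blast
  moreover have "prime_elem (int p)"
    using p by simp
  ultimately have "multiplicity (int p) a + multiplicity (int p) d
                 = multiplicity (int p) c + multiplicity (int p) b"
    using ab c d prime_elem_multiplicity_mult_distrib[of "int p"] by (metis less_irrefl)
  then have "int (multiplicity (int p) d) - int (multiplicity (int p) c)
           = int (multiplicity (int p) b) - int (multiplicity (int p) a)"
    by linarith
  then show ?thesis
    using ab by (simp add: rat_padic_norm_def cd)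
qed

lemma rat_eq_frac: obtains a b where "b > 0" "(r :: rat) = of_int a / of_int b"
  using quotient_of_denom_pos quotient_of_div by (metis surj_pair)

lemma rat_eq_common_frac:
  obtains a b d where "d \<noteq> 0" "(r :: rat) = of_int a / of_int d" "(s :: rat) = of_int b / of_int d"
proof -
  obtain a d where 1: "d > 0" "r = of_int a / of_int d" by (rule rat_eq_frac)
  obtain b e where 2: "e > 0" "s = of_int b / of_int e" by (rule rat_eq_frac)
  show ?thesis
    by (rule that[of "d * e" "a * e" "b * d"]) (use 1 2 in \<open>auto simp: field_simps\<close>)
qed

lemma rat_padic_norm_pos:
  assumes "prime p" "r \<noteq> 0"
  shows "rat_padic_norm p r > 0"
  using assms prime_gt_0_nat[of p] by (simp add: rat_padic_norm_def)

lemma rat_padic_norm_ge_0: "prime p \<Longrightarrow> rat_padic_norm p r \<ge> 0"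
  using rat_padic_norm_pos[of p r] by (cases "r = 0") (simp_all add: less_imp_le)

lemma rat_padic_norm_mult:
  assumes p: "prime p"
  shows "rat_padic_norm p (r * s) = rat_padic_norm p r * rat_padic_norm p s"
proof (cases "r = 0 \<or> s = 0")
  case False
  obtain a b where ab: "b > 0" "r = of_int a / of_int b" by (rule rat_eq_frac)
  obtain c d where cd: "d > 0" "s = of_int c / of_int d" by (rule rat_eq_frac)
  have nz: "a \<noteq> 0" "b \<noteq> 0" "c \<noteq> 0" "d \<noteq> 0" "real p \<noteq> 0" "prime_elem (int p)"
    using False ab cd p by auto
  have "r * s = of_int (a * c) / of_int (b * d)"
    by (simp add: ab cd)
  then have "rat_padic_norm p (r * s) = real p powi (int (multiplicity (int p) (b * d)) - int (multiplicity (int p) (a * c)))"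
    using rat_padic_norm_frac[OF p, of "a * c" "b * d"] nz by simp
  also have "\<dots> = real p powi ((int (multiplicity (int p) b) - int (multiplicity (int p) a))
                 + (int (multiplicity (int p) d) - int (multiplicity (int p) c)))"
    using nz by (simp add: prime_elem_multiplicity_mult_distrib algebra_simps)
  also have "\<dots> = rat_padic_norm p r * rat_padic_norm p s"
    using nz by (simp add: ab cd rat_padic_norm_frac[OF p] power_int_add)
  finally show ?thesis .
qed auto

lemma rat_padic_norm_add:
  assumes p: "prime p"
  shows "rat_padic_norm p (r + s) \<le> max (rat_padic_norm p r) (rat_padic_norm p s)"
proof (cases "r = 0 \<or> s = 0 \<or> r + s = 0")
  case False
  obtain a b d where d: "d \<noteq> 0" "r = of_int a / of_int d" "s = of_int b / of_int d"
    by (rule rat_eq_common_frac)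
  have rs: "r + s = of_int (a + b) / of_int d"
    by (simp add: d add_divide_distrib)
  have nz: "a \<noteq> 0" "b \<noteq> 0" "a + b \<noteq> 0"
    using False d rs by auto
  define m where "m = min (multiplicity (int p) a) (multiplicity (int p) b)"
  have "int p ^ m dvd a + b"
    by (intro dvd_add multiplicity_dvd') (auto simp: m_def)
  moreover have "\<not> is_unit (int p)"
    using p by (metis not_prime_unit prime_nat_int_transfer)
  ultimately have "m \<le> multiplicity (int p) (a + b)"
    using nz by (intro multiplicity_geI) auto
  then have "rat_padic_norm p (r + s) \<le> real p powi (int (multiplicity (int p) d) - int m)"
    unfolding rs using prime_ge_1_nat[OF p] d nz
    by (subst rat_padic_norm_frac[OF p]) (auto intro!: power_int_increasing)
  also have "\<dots> \<le> max (rat_padic_norm p r) (rat_padic_norm p s)"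
    using d nz by (auto simp: rat_padic_norm_frac[OF p] m_def min_def)
  finally show ?thesis .
qed (use rat_padic_norm_ge_0[OF p] in \<open>auto simp: max_def\<close>)

lemma rat_padic_norm_1: "prime p \<Longrightarrow> rat_padic_norm p 1 = 1"
  using rat_padic_norm_frac[of p 1 1] by simp

lemma rat_padic_norm_minus: "prime p \<Longrightarrow> rat_padic_norm p (- r) = rat_padic_norm p r"
proof -
  assume p: "prime p"
  have "rat_padic_norm p (- 1) = 1"
    using rat_padic_norm_frac[OF p, of "- 1" 1] by (simp add: multiplicity_unit_right)
  then show ?thesis
    using rat_padic_norm_mult[OF p, of "- 1" r] by simp
qed

lemma rat_padic_norm_self: "prime p \<Longrightarrow> rat_padic_norm p (of_nat p) = 1 / real p"
  using rat_padic_norm_frac[of p "int p" 1] prime_gt_0_nat[of p]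
  by (simp add: power_int_minus divide_inverse)

lemma rat_padic_norm_inverse:
  assumes p: "prime p"
  shows "rat_padic_norm p (inverse r) = inverse (rat_padic_norm p r)"
proof (cases "r = 0")
  case False
  have "rat_padic_norm p r * rat_padic_norm p (inverse r) = 1"
    using False rat_padic_norm_mult[OF p, of r "inverse r"] rat_padic_norm_1[OF p] by simp
  then show ?thesis
    by (simp add: inverse_unique)
qed auto


section \<open>The field of p-adic numbers\<close>

text \<open>The prime is the cardinality of the type parameter. The field is the ring of
  rational sequences that are Cauchy for the p-adic absolute value, modulo null sequences.\<close>

abbreviation qnorm :: "'p::prime_card itself \<Rightarrow> rat \<Rightarrow> real" where
  "qnorm _ \<equiv> rat_padic_norm CARD('p)"

lemmas qnorm_mult = rat_padic_norm_mult[OF prime_card]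
  and qnorm_add = rat_padic_norm_add[OF prime_card]
  and qnorm_ge_0 [simp] = rat_padic_norm_ge_0[OF prime_card]
  and qnorm_pos = rat_padic_norm_pos[OF prime_card]
  and qnorm_1 [simp] = rat_padic_norm_1[OF prime_card]
  and qnorm_minus [simp] = rat_padic_norm_minus[OF prime_card]
  and qnorm_inverse [simp] = rat_padic_norm_inverse[OF prime_card]
  and qnorm_self [simp] = rat_padic_norm_self[OF prime_card]

lemma qnorm_eq_0_iff [simp]: "qnorm TYPE('p::prime_card) r = 0 \<longleftrightarrow> r = 0"
  using qnorm_pos[where 'a = 'p, of r] by (cases "r = 0") auto

lemma qnorm_triangle:
  "qnorm TYPE('p::prime_card) (r + s) \<le> qnorm TYPE('p) r + qnorm TYPE('p) s"
  using qnorm_add[where 'a = 'p, of r s] qnorm_ge_0[where 'a = 'p, of r] qnorm_ge_0[where 'a = 'p, of s]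
  by linarith

lemma qnorm_diff_commute: "qnorm TYPE('p::prime_card) (r - s) = qnorm TYPE('p) (s - r)"
  by (metis minus_diff_eq qnorm_minus)

lemma qnorm_triangle3:
  "\<bar>qnorm TYPE('p::prime_card) r - qnorm TYPE('p) s\<bar> \<le> qnorm TYPE('p) (r - s)"
  using qnorm_triangle[where 'p = 'p, of "r - s" s] qnorm_triangle[where 'p = 'p, of "s - r" r]
    qnorm_diff_commute[where 'p = 'p, of r s]
  by auto

definition padic_cauchy :: "'p::prime_card itself \<Rightarrow> (nat \<Rightarrow> rat) \<Rightarrow> bool" where
  "padic_cauchy T X \<longleftrightarrow> (\<forall>e>0. \<exists>M. \<forall>m\<ge>M. \<forall>n\<ge>M. qnorm T (X m - X n) < e)"

definition padic_null :: "'p::prime_card itself \<Rightarrow> (nat \<Rightarrow> rat) \<Rightarrow> bool" where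
  "padic_null T X \<longleftrightarrow> (\<lambda>n. qnorm T (X n)) \<longlonglongrightarrow> 0"

lemma padic_cauchyE:
  assumes "padic_cauchy T X" "e > 0"
  obtains M where "\<And>m n. m \<ge> M \<Longrightarrow> n \<ge> M \<Longrightarrow> qnorm T (X m - X n) < e"
  using assms unfolding padic_cauchy_def by blast

lemma padic_cauchy_const [simp]: "padic_cauchy T (\<lambda>_. c)"
  by (simp add: padic_cauchy_def)

lemma padic_cauchy_norm_convergent:
  assumes "padic_cauchy TYPE('p::prime_card) X"
  shows "convergent (\<lambda>n. qnorm TYPE('p) (X n))"
proof -
  have "Cauchy (\<lambda>n. qnorm TYPE('p) (X n))"
  proof (rule metric_CauchyI)
    fix e :: real assume "e > 0"
    then obtain M where M: "\<And>m n. m \<ge> M \<Longrightarrow> n \<ge> M \<Longrightarrow> qnorm TYPE('p) (X m - X n) < e"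
      using assms unfolding padic_cauchy_def by blast
    have "dist (qnorm TYPE('p) (X m)) (qnorm TYPE('p) (X n)) < e" if "m \<ge> M" "n \<ge> M" for m n
      using qnorm_triangle3[where 'p = 'p, of "X m" "X n"] M[OF that] by (simp add: dist_real_def)
    then show "\<exists>M. \<forall>m\<ge>M. \<forall>n\<ge>M. dist (qnorm TYPE('p) (X m)) (qnorm TYPE('p) (X n)) < e"
      by blast
  qed
  then show ?thesis
    by (rule Cauchy_convergent)
qed

lemma padic_cauchy_bounded:
  assumes "padic_cauchy TYPE('p::prime_card) X"
  obtains B where "B > 0" "\<And>n. qnorm TYPE('p) (X n) \<le> B"
proof -
  have "Bseq (\<lambda>n. qnorm TYPE('p) (X n))"
    using assms convergent_imp_Bseq padic_cauchy_norm_convergent by blast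
  then show ?thesis
    using that by (auto simp: Bseq_def)
qed

lemma padic_cauchy_add:
  assumes X: "padic_cauchy TYPE('p::prime_card) X" and Y: "padic_cauchy TYPE('p) Y"
  shows "padic_cauchy TYPE('p) (\<lambda>n. X n + Y n)"
  unfolding padic_cauchy_def
proof (intro allI impI)
  fix e :: real assume "e > 0"
  obtain M where M: "\<And>m n. m \<ge> M \<Longrightarrow> n \<ge> M \<Longrightarrow> qnorm TYPE('p) (X m - X n) < e"
    by (rule padic_cauchyE[OF X \<open>e > 0\<close>]) (rule that, blast)
  obtain N where N: "\<And>m n. m \<ge> N \<Longrightarrow> n \<ge> N \<Longrightarrow> qnorm TYPE('p) (Y m - Y n) < e"
    by (rule padic_cauchyE[OF Y \<open>e > 0\<close>]) (rule that, blast)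
  have "qnorm TYPE('p) (X m + Y m - (X n + Y n)) < e" if "m \<ge> max M N" "n \<ge> max M N" for m n
  proof -
    have "qnorm TYPE('p) (X m - X n) < e" "qnorm TYPE('p) (Y m - Y n) < e"
      using M[of m n] N[of m n] that by simp_all
    then show ?thesis
      unfolding add_diff_add
      by (intro le_less_trans[OF qnorm_add]) simp
  qed
  then show "\<exists>M. \<forall>m\<ge>M. \<forall>n\<ge>M. qnorm TYPE('p) (X m + Y m - (X n + Y n)) < e"
    by blast
qed

lemma padic_cauchy_minus:
  "padic_cauchy TYPE('p::prime_card) X \<Longrightarrow> padic_cauchy TYPE('p) (\<lambda>n. - X n)"
  by (simp only: padic_cauchy_def minus_diff_minus qnorm_minus)

lemma padic_cauchy_diff:
  assumes "padic_cauchy TYPE('p::prime_card) X" "padic_cauchy TYPE('p) Y"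
  shows "padic_cauchy TYPE('p) (\<lambda>n. X n - Y n)"
  using padic_cauchy_add[OF assms(1) padic_cauchy_minus[OF assms(2)]] by simp

lemma padic_cauchy_mult:
  assumes X: "padic_cauchy TYPE('p::prime_card) X" and Y: "padic_cauchy TYPE('p) Y"
  shows "padic_cauchy TYPE('p) (\<lambda>n. X n * Y n)"
  unfolding padic_cauchy_def
proof (intro allI impI)
  fix e :: real assume e: "e > 0"
  obtain A where A: "A > 0" "\<And>n. qnorm TYPE('p) (X n) \<le> A" using padic_cauchy_bounded[OF X] by blast
  obtain B where B: "B > 0" "\<And>n. qnorm TYPE('p) (Y n) \<le> B" using padic_cauchy_bounded[OF Y] by blast
  obtain M where M: "\<And>m n. m \<ge> M \<Longrightarrow> n \<ge> M \<Longrightarrow> qnorm TYPE('p) (X m - X n) < e / B"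
    by (rule padic_cauchyE[OF X divide_pos_pos[OF e B(1)]]) (rule that, blast)
  obtain N where N: "\<And>m n. m \<ge> N \<Longrightarrow> n \<ge> N \<Longrightarrow> qnorm TYPE('p) (Y m - Y n) < e / A"
    by (rule padic_cauchyE[OF Y divide_pos_pos[OF e A(1)]]) (rule that, blast)
  have "qnorm TYPE('p) (X m * Y m - X n * Y n) < e" if "m \<ge> max M N" "n \<ge> max M N" for m n
  proof -
    have "qnorm TYPE('p) (X m * (Y m - Y n)) \<le> A * qnorm TYPE('p) (Y m - Y n)"
      using A by (simp add: qnorm_mult mult_right_mono)
    also have "\<dots> < e"
      using N[of m n] that A by (simp add: field_simps)
    finally have 1: "qnorm TYPE('p) (X m * (Y m - Y n)) < e" .
    have "qnorm TYPE('p) ((X m - X n) * Y n) \<le> qnorm TYPE('p) (X m - X n) * B"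
      using B by (simp add: qnorm_mult mult_left_mono)
    also have "\<dots> < e"
      using M[of m n] that B by (simp add: field_simps)
    finally have 2: "qnorm TYPE('p) ((X m - X n) * Y n) < e" .
    show ?thesis
      using qnorm_add[where 'a = 'p, of "X m * (Y m - Y n)" "(X m - X n) * Y n"] 1 2
      by (simp add: algebra_simps)
  qed
  then show "\<exists>M. \<forall>m\<ge>M. \<forall>n\<ge>M. qnorm TYPE('p) (X m * Y m - X n * Y n) < e"
    by blast
qed

lemma padic_null_add:
  assumes "padic_null TYPE('p::prime_card) X" "padic_null TYPE('p) Y"
  shows "padic_null TYPE('p) (\<lambda>n. X n + Y n)"
proof -
  have "(\<lambda>n. qnorm TYPE('p) (X n) + qnorm TYPE('p) (Y n)) \<longlonglongrightarrow> 0 + 0"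
    using assms unfolding padic_null_def by (intro tendsto_add)
  then have lim: "(\<lambda>n. qnorm TYPE('p) (X n) + qnorm TYPE('p) (Y n)) \<longlonglongrightarrow> 0"
    by simp
  show ?thesis
    unfolding padic_null_def
    by (rule tendsto_sandwich[OF _ _ tendsto_const lim])
       (simp_all add: qnorm_triangle)
qed

lemma padic_null_minus: "padic_null TYPE('p::prime_card) (\<lambda>n. - X n) \<longleftrightarrow> padic_null TYPE('p) X"
  by (simp add: padic_null_def)

lemma padic_null_mult_cauchy:
  assumes X: "padic_null TYPE('p::prime_card) X" and Y: "padic_cauchy TYPE('p) Y"
  shows "padic_null TYPE('p) (\<lambda>n. X n * Y n)"
proof -
  obtain L where "(\<lambda>n. qnorm TYPE('p) (Y n)) \<longlonglongrightarrow> L"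
    using padic_cauchy_norm_convergent[OF Y] by (auto simp: convergent_def)
  then have "(\<lambda>n. qnorm TYPE('p) (X n) * qnorm TYPE('p) (Y n)) \<longlonglongrightarrow> 0 * L"
    using X unfolding padic_null_def by (intro tendsto_mult)
  then show ?thesis
    by (simp add: padic_null_def qnorm_mult)
qed

lemma padic_cauchy_not_null:
  assumes X: "padic_cauchy TYPE('p::prime_card) X" and nz: "\<not> padic_null TYPE('p) X"
  obtains L where "L > 0" "(\<lambda>n. qnorm TYPE('p) (X n)) \<longlonglongrightarrow> L" "eventually (\<lambda>n. X n \<noteq> 0) sequentially"
proof -
  obtain L where L: "(\<lambda>n. qnorm TYPE('p) (X n)) \<longlonglongrightarrow> L"
    using padic_cauchy_norm_convergent[OF X] by (auto simp: convergent_def)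
  moreover have "L \<ge> 0"
    using L by (rule LIMSEQ_le_const) auto
  moreover have "L \<noteq> 0"
    using nz L by (auto simp: padic_null_def)
  ultimately have "L > 0" by simp
  then have "eventually (\<lambda>n. qnorm TYPE('p) (X n) > 0) sequentially"
    using L order_tendstoD(1) by blast
  then have "eventually (\<lambda>n. X n \<noteq> 0) sequentially"
    by eventually_elim auto
  with L \<open>L > 0\<close> show ?thesis
    using that by blast
qed

lemma padic_cauchy_inverse:
  assumes X: "padic_cauchy TYPE('p::prime_card) X" and nz: "\<not> padic_null TYPE('p) X"
  shows "padic_cauchy TYPE('p) (\<lambda>n. inverse (X n))"
  unfolding padic_cauchy_def
proof (intro allI impI)
  fix e :: real assume e: "e > 0"
  obtain L where L: "L > 0" "(\<lambda>n. qnorm TYPE('p) (X n)) \<longlonglongrightarrow> L"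
    using padic_cauchy_not_null[OF X nz] by blast
  have "eventually (\<lambda>n. qnorm TYPE('p) (X n) > L / 2) sequentially"
    using L by (intro order_tendstoD(1)[OF L(2)]) auto
  then obtain K where K: "\<And>n. n \<ge> K \<Longrightarrow> qnorm TYPE('p) (X n) > L / 2"
    by (auto simp: eventually_sequentially)
  have pos: "e * (L / 2 * (L / 2)) > 0"
    using e L by simp
  obtain M where M: "\<And>m n. m \<ge> M \<Longrightarrow> n \<ge> M \<Longrightarrow> qnorm TYPE('p) (X m - X n) < e * (L / 2 * (L / 2))"
    by (rule padic_cauchyE[OF X pos]) (rule that, blast)
  have "qnorm TYPE('p) (inverse (X m) - inverse (X n)) < e" if "m \<ge> max K M" "n \<ge> max K M" for m n
  proof -
    have gt: "qnorm TYPE('p) (X m) > L / 2" "qnorm TYPE('p) (X n) > L / 2"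
      using K that by auto
    have nz: "X m \<noteq> 0" "X n \<noteq> 0"
      using gt L(1) by auto
    have "inverse (X m) - inverse (X n) = inverse (X m) * inverse (X n) * (X n - X m)"
      using nz by (simp add: field_simps)
    then have "qnorm TYPE('p) (inverse (X m) - inverse (X n))
             = qnorm TYPE('p) (X m - X n) / (qnorm TYPE('p) (X m) * qnorm TYPE('p) (X n))"
      by (simp add: qnorm_mult qnorm_diff_commute[where 'p = 'p, of "X n" "X m"] divide_inverse)
    also have "\<dots> \<le> qnorm TYPE('p) (X m - X n) / (L / 2 * (L / 2))"
      using gt L(1) by (intro divide_left_mono mult_mono mult_pos_pos) auto
    also have "\<dots> < e"
      using M[of m n] that L(1) by (simp add: divide_simps mult_ac)
    finally show ?thesis .
  qed
  then show "\<exists>M. \<forall>m\<ge>M. \<forall>n\<ge>M. qnorm TYPE('p) (inverse (X m) - inverse (X n)) < e"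
    by blast
qed

typedef (overloaded) ('p::prime_card) padic_seq = "{X. padic_cauchy TYPE('p) X}"
  morphisms seq_of Padic_Seq
  by (rule exI[of _ "\<lambda>_. 0"]) simp

setup_lifting type_definition_padic_seq

instantiation padic_seq :: (prime_card) comm_ring_1
begin

lift_definition zero_padic_seq :: "'a padic_seq" is "\<lambda>_. 0" by simp
lift_definition one_padic_seq :: "'a padic_seq" is "\<lambda>_. 1" by simp
lift_definition plus_padic_seq :: "'a padic_seq \<Rightarrow> 'a padic_seq \<Rightarrow> 'a padic_seq"
  is "\<lambda>X Y n. X n + Y n" by (rule padic_cauchy_add)
lift_definition uminus_padic_seq :: "'a padic_seq \<Rightarrow> 'a padic_seq"
  is "\<lambda>X n. - X n" by (rule padic_cauchy_minus)
lift_definition minus_padic_seq :: "'a padic_seq \<Rightarrow> 'a padic_seq \<Rightarrow> 'a padic_seq"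
  is "\<lambda>X Y n. X n - Y n" by (rule padic_cauchy_diff)
lift_definition times_padic_seq :: "'a padic_seq \<Rightarrow> 'a padic_seq \<Rightarrow> 'a padic_seq"
  is "\<lambda>X Y n. X n * Y n" by (rule padic_cauchy_mult)

instance
  by (standard; transfer) (auto simp: algebra_simps fun_eq_iff)

end

lift_definition null_seq :: "'p::prime_card padic_seq \<Rightarrow> bool" is "padic_null TYPE('p)" .

lift_definition inverse_seq :: "'p::prime_card padic_seq \<Rightarrow> 'p padic_seq"
  is "\<lambda>X. if padic_null TYPE('p) X then (\<lambda>_. 0) else (\<lambda>n. inverse (X n))"
  by (simp add: padic_cauchy_inverse)

lift_definition norm_seq :: "'p::prime_card padic_seq \<Rightarrow> real"
  is "\<lambda>X. lim (\<lambda>n. qnorm TYPE('p) (X n))" .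

lift_definition const_seq :: "rat \<Rightarrow> 'p::prime_card padic_seq" is "\<lambda>r _. r" by simp

lemma null_seq_0 [simp]: "null_seq 0"
  by transfer (simp add: padic_null_def)

lemma null_seq_add: "null_seq X \<Longrightarrow> null_seq Y \<Longrightarrow> null_seq (X + Y)"
  by transfer (rule padic_null_add)

lemma null_seq_minus [simp]: "null_seq (- X) \<longleftrightarrow> null_seq X"
  by transfer (rule padic_null_minus)

lemma null_seq_diff: "null_seq X \<Longrightarrow> null_seq Y \<Longrightarrow> null_seq (X - Y)"
  using null_seq_add[of X "- Y"] by simp

lemma null_seq_mult: "null_seq X \<Longrightarrow> null_seq (X * Y)"
  by transfer (rule padic_null_mult_cauchy)

lemma null_seq_mult': "null_seq X \<Longrightarrow> null_seq (Y * X)"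
  using null_seq_mult[of X Y] by (simp add: mult.commute)

lemma null_seq_inverse: "\<not> null_seq X \<Longrightarrow> null_seq (inverse_seq X * X - 1)"
proof transfer
  fix X assume X: "padic_cauchy TYPE('a) X" "\<not> padic_null TYPE('a) X"
  then have "eventually (\<lambda>n. X n \<noteq> 0) sequentially"
    using padic_cauchy_not_null by blast
  then have "eventually (\<lambda>n. qnorm TYPE('a) (inverse (X n) * X n - 1) = 0) sequentially"
    by eventually_elim simp
  then show "padic_null TYPE('a) (\<lambda>n. (if padic_null TYPE('a) X then \<lambda>_. 0 else (\<lambda>n. inverse (X n))) n * X n - 1)"
    using X by (simp add: padic_null_def tendsto_eventually)
qed

lemma norm_seq_LIMSEQ: "(\<lambda>n. qnorm TYPE('p::prime_card) (seq_of X n)) \<longlonglongrightarrow> norm_seq (X :: 'p padic_seq)"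
  using padic_cauchy_norm_convergent seq_of[of X]
  by (auto simp: norm_seq.rep_eq convergent_LIMSEQ_iff)

lemma norm_seqI: "(\<lambda>n. qnorm TYPE('p::prime_card) (seq_of X n)) \<longlonglongrightarrow> L \<Longrightarrow> norm_seq (X :: 'p padic_seq) = L"
  using norm_seq_LIMSEQ LIMSEQ_unique by blast

lemma null_seq_iff: "null_seq X \<longleftrightarrow> norm_seq X = 0"
  using norm_seq_LIMSEQ[of X] norm_seqI[of X 0] by (auto simp: null_seq.rep_eq padic_null_def)

lemma norm_seq_add: "norm_seq (X + Y) \<le> max (norm_seq X) (norm_seq Y)"
  by (rule LIMSEQ_le[OF norm_seq_LIMSEQ tendsto_max[OF norm_seq_LIMSEQ norm_seq_LIMSEQ]])
     (auto simp: plus_padic_seq.rep_eq qnorm_add)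

lemma norm_seq_mult: "norm_seq (X * Y) = norm_seq X * norm_seq Y"
  by (rule norm_seqI)
     (auto simp: times_padic_seq.rep_eq qnorm_mult intro!: tendsto_mult norm_seq_LIMSEQ)

lemma norm_seq_minus: "norm_seq (- X) = norm_seq X"
  by (rule norm_seqI) (use norm_seq_LIMSEQ in \<open>auto simp: uminus_padic_seq.rep_eq\<close>)

lemma norm_seq_ge_0: "norm_seq X \<ge> 0"
  by (rule LIMSEQ_le_const[OF norm_seq_LIMSEQ]) auto

lemma norm_seq_const: "norm_seq (const_seq r :: 'p::prime_card padic_seq) = qnorm TYPE('p) r"
  by (rule norm_seqI) (simp add: const_seq.rep_eq)

quotient_type (overloaded) 'p padic = "'p::prime_card padic_seq" / "\<lambda>X Y. null_seq (X - Y)"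
proof (rule equivpI)
  show "reflp (\<lambda>X Y :: 'p padic_seq. null_seq (X - Y))"
    by (auto intro: reflpI)
  show "symp (\<lambda>X Y :: 'p padic_seq. null_seq (X - Y))"
  proof (rule sympI)
    fix X Y :: "'p padic_seq" assume "null_seq (X - Y)"
    then show "null_seq (Y - X)"
      using null_seq_minus[of "X - Y"] by (simp only: minus_diff_eq)
  qed
  show "transp (\<lambda>X Y :: 'p padic_seq. null_seq (X - Y))"
  proof (rule transpI)
    fix X Y Z :: "'p padic_seq" assume "null_seq (X - Y)" "null_seq (Y - Z)"
    then have "null_seq ((X - Y) + (Y - Z))"
      by (rule null_seq_add)
    then show "null_seq (X - Z)"
      by simp
  qed
qed

instantiation padic :: (prime_card) field
begin

lift_definition zero_padic :: "'a padic" is 0 .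
lift_definition one_padic :: "'a padic" is 1 .
lift_definition plus_padic :: "'a padic \<Rightarrow> 'a padic \<Rightarrow> 'a padic" is "(+)"
  by (simp only: add_diff_add null_seq_add)
lift_definition uminus_padic :: "'a padic \<Rightarrow> 'a padic" is uminus
  by (simp only: minus_diff_minus null_seq_minus)
lift_definition minus_padic :: "'a padic \<Rightarrow> 'a padic \<Rightarrow> 'a padic" is "(-)"
proof -
  fix X Y U V :: "'a padic_seq"
  assume "null_seq (X - Y)" "null_seq (U - V)"
  then have "null_seq ((X - Y) - (U - V))"
    by (rule null_seq_diff)
  then show "null_seq (X - U - (Y - V))"
    by (simp add: algebra_simps)
qed
lift_definition times_padic :: "'a padic \<Rightarrow> 'a padic \<Rightarrow> 'a padic" is "(*)"
  by (simp only: mult_diff_mult null_seq_add null_seq_mult null_seq_mult')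
lift_definition inverse_padic :: "'a padic \<Rightarrow> 'a padic" is inverse_seq
proof -
  fix X Y :: "'a padic_seq"
  assume XY: "null_seq (X - Y)"
  show "null_seq (inverse_seq X - inverse_seq Y)"
  proof (cases "null_seq X \<or> null_seq Y")
    case True
    then have "null_seq X \<and> null_seq Y"
    proof
      assume "null_seq X"
      with null_seq_diff[OF this XY] show ?thesis by simp
    next
      assume "null_seq Y"
      with null_seq_add[OF XY this] show ?thesis by simp
    qed
    then have "inverse_seq X = 0" "inverse_seq Y = 0"
      by (transfer; simp)+
    then show ?thesis by simp
  next
    case False
    define a where "a = inverse_seq X * X - 1"
    define b where "b = inverse_seq Y * Y - 1"
    have "null_seq a" "null_seq b"
      using False null_seq_inverse by (auto simp: a_def b_def)
    moreover have "inverse_seq X - inverse_seq Y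
        = inverse_seq Y * a - inverse_seq X * b - inverse_seq X * inverse_seq Y * (X - Y)"
      by (simp add: a_def b_def algebra_simps)
    ultimately show ?thesis
      using XY by (simp add: null_seq_diff null_seq_mult')
  qed
qed

definition "x div y = x * inverse y" for x y :: "'a padic"

instance
proof
  show "(0 :: 'a padic) \<noteq> 1"
    by transfer (simp add: null_seq_iff norm_seq_minus, transfer, simp)
  show "x \<noteq> 0 \<Longrightarrow> inverse x * x = 1" for x :: "'a padic"
    by transfer (simp add: null_seq_inverse)
  show "inverse (0 :: 'a padic) = 0"
    by transfer (simp, transfer, simp add: padic_null_def)
  show "x div y = x * inverse y" for x y :: "'a padic"
    by (rule divide_padic_def)
qed (transfer; simp add: algebra_simps)+

end

lift_definition padic_norm :: "'a::prime_card padic \<Rightarrow> real" is norm_seq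
proof -
  have le: "norm_seq X \<le> norm_seq Y" if "null_seq (X - Y)" for X Y :: "'a padic_seq"
    using norm_seq_add[of "X - Y" Y] that norm_seq_ge_0[of Y] by (simp add: null_seq_iff)
  fix X Y :: "'a padic_seq"
  assume XY: "null_seq (X - Y)"
  then have "null_seq (Y - X)"
    using null_seq_minus[of "X - Y"] by (simp only: minus_diff_eq)
  with XY show "norm_seq X = norm_seq Y"
    by (intro antisym le)
qed

lemma padic_norm_eq_0 [simp]: "padic_norm x = 0 \<longleftrightarrow> x = 0" for x :: "'a::prime_card padic"
  by transfer (simp add: null_seq_iff)

lemma padic_norm_0 [simp]: "padic_norm (0 :: 'a::prime_card padic) = 0"
  by simp

lemma padic_norm_add: "padic_norm (x + y) \<le> max (padic_norm x) (padic_norm y)" for x y :: "'a::prime_card padic"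
  by transfer (rule norm_seq_add)

lemma padic_norm_ge_0 [simp]: "padic_norm x \<ge> 0" for x :: "'a::prime_card padic"
  by transfer (rule norm_seq_ge_0)

lemma padic_norm_minus [simp]: "padic_norm (- x) = padic_norm x" for x :: "'a::prime_card padic"
  by transfer (rule norm_seq_minus)

lemma padic_norm_diff_commute: "padic_norm (x - y) = padic_norm (y - x)" for x y :: "'a::prime_card padic"
  by (metis minus_diff_eq padic_norm_minus)

instantiation padic :: (prime_card) metric_space
begin

definition "dist x y = padic_norm (x - y)" for x y :: "'a padic"

definition uniformity_padic :: "('a padic \<times> 'a padic) filter" where
  "uniformity_padic = (INF e\<in>{0<..}. principal {(x, y). dist x y < e})"

definition open_padic :: "'a padic set \<Rightarrow> bool" where
  "open_padic U \<longleftrightarrow> (\<forall>x\<in>U. eventually (\<lambda>(x', y). x' = x \<longrightarrow> y \<in> U) uniformity)"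

instance
proof
  show "dist x y = 0 \<longleftrightarrow> x = y" for x y :: "'a padic"
    by (simp add: dist_padic_def)
  show "dist x y \<le> dist x z + dist y z" for x y z :: "'a padic"
  proof -
    have "x - y = (x - z) + (z - y)"
      by simp
    then have "padic_norm (x - y) \<le> max (padic_norm (x - z)) (padic_norm (z - y))"
      using padic_norm_add by metis
    also have "padic_norm (z - y) = padic_norm (y - z)"
      by (rule padic_norm_diff_commute)
    also have "max (padic_norm (x - z)) (padic_norm (y - z)) \<le> padic_norm (x - z) + padic_norm (y - z)"
      by simp
    finally show ?thesis
      by (simp add: dist_padic_def)
  qed
qed (simp_all add: uniformity_padic_def open_padic_def)

end

lemma padic_norm_mult: "padic_norm (x * y) = padic_norm x * padic_norm y" for x y :: "'p::prime_card padic"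
  by transfer (rule norm_seq_mult)

lemma padic_norm_1 [simp]: "padic_norm (1 :: 'p::prime_card padic) = 1"
proof -
  have "(1 :: 'p padic) * 1 = 1" "(1 :: 'p padic) \<noteq> 0" by simp_all
  then have "padic_norm (1 :: 'p padic) * padic_norm (1 :: 'p padic) = padic_norm (1 :: 'p padic)" "padic_norm (1 :: 'p padic) \<noteq> 0"
    by (metis padic_norm_mult, simp)
  then show ?thesis by simp
qed

lemma padic_norm_power: "padic_norm (x ^ n) = padic_norm x ^ n" for x :: "'p::prime_card padic"
  by (induction n) (simp_all add: padic_norm_mult)

lemma padic_norm_inverse: "padic_norm (inverse x) = inverse (padic_norm x)" for x :: "'p::prime_card padic"
proof (cases "x = 0")
  case False
  then have "padic_norm x * padic_norm (inverse x) = 1"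
    by (simp flip: padic_norm_mult)
  then show ?thesis by (simp add: inverse_unique)
qed simp

lemma of_nat_padic_seq: "(of_nat n :: 'p::prime_card padic_seq) = const_seq (of_nat n)"
  by (induction n) (simp_all, (transfer; simp)+)

lemma abs_of_nat_padic: "abs_padic (of_nat n) = (of_nat n :: 'p::prime_card padic)"
  by (induction n) (simp_all flip: zero_padic.abs_eq one_padic.abs_eq plus_padic.abs_eq)

lemma norm_of_nat_padic: "padic_norm (of_nat n :: 'p::prime_card padic) = rat_padic_norm CARD('p) (of_nat n)"
  by (simp flip: abs_of_nat_padic
      add: padic_norm.abs_eq of_nat_padic_seq norm_seq_const)

instance padic :: (prime_card) field_char_0
proof
  have nz: "(of_nat n :: 'a padic) \<noteq> 0" if "n > 0" for n
  proof -
    have "padic_norm (of_nat n :: 'a padic) > 0"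
      using that by (simp add: norm_of_nat_padic qnorm_pos)
    then show ?thesis
      using padic_norm_0 by (metis less_irrefl)
  qed
  show "inj (of_nat :: nat \<Rightarrow> 'a padic)"
  proof (rule injI)
    fix m n :: nat
    assume eq: "(of_nat m :: 'a padic) = of_nat n"
    have "m \<le> n" if "(of_nat m :: 'a padic) = of_nat n" for m n :: nat
    proof (rule ccontr)
      assume "\<not> m \<le> n"
      then have "(of_nat (m - n) :: 'a padic) = 0"
        using that by (simp add: of_nat_diff)
      with nz[of "m - n"] \<open>\<not> m \<le> n\<close> show False by simp
    qed
    from this[OF eq] this[OF eq[symmetric]] show "m = n"
      by simp
  qed
qed

lemma padic_norm_p: "padic_norm (of_nat CARD('p) :: 'p::prime_card padic) = 1 / real CARD('p)"
  by (simp add: norm_of_nat_padic)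

lemma norm_of_int_padic:
  "padic_norm (of_int k :: 'p::prime_card padic) = rat_padic_norm CARD('p) (of_int k)"
  by (cases k rule: int_cases2) (simp_all add: norm_of_nat_padic)

lemma norm_of_rat_padic: "padic_norm (of_rat r :: 'p::prime_card padic) = rat_padic_norm CARD('p) r"
proof -
  obtain a b where ab: "b > 0" "r = of_int a / of_int b" by (rule rat_eq_frac)
  then show ?thesis
    by (simp add: of_rat_divide divide_inverse of_rat_mult of_rat_inverse padic_norm_mult padic_norm_inverse norm_of_int_padic qnorm_mult)
qed

lemma of_rat_padic: "(of_rat r :: 'p::prime_card padic) = abs_padic (const_seq r)"
proof -
  obtain a b where ab: "b > 0" "r = of_int a / of_int b" by (rule rat_eq_frac)
  have hom: "abs_padic (const_seq (x * y)) = (abs_padic (const_seq x) * abs_padic (const_seq y) :: 'p padic)" for x y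
    unfolding times_padic.abs_eq by (rule arg_cong[where f = abs_padic]) (transfer; simp)
  have nat: "abs_padic (const_seq (of_nat n)) = (of_nat n :: 'p padic)" for n
    by (simp flip: of_nat_padic_seq add: abs_of_nat_padic)
  have minus: "abs_padic (const_seq (- x)) = (- abs_padic (const_seq x) :: 'p padic)" for x
    unfolding uminus_padic.abs_eq by (rule arg_cong[where f = abs_padic]) (transfer; simp)
  have int: "abs_padic (const_seq (of_int k)) = (of_int k :: 'p padic)" for k
    by (cases k rule: int_cases2) (simp_all add: nat minus)
  have "abs_padic (const_seq r) * of_int b = (of_int a :: 'p padic)"
    using ab by (simp flip: int hom)
  then show ?thesis
    using ab(1) by (simp add: ab(2) of_rat_divide divide_eq_eq)
qed

lemma padic_rat_dense:
  fixes x :: "'p::prime_card padic"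
  assumes "e > 0"
  obtains r where "padic_norm (x - of_rat r) < e"
proof -
  obtain X where X: "x = abs_padic X"
    by (metis Quotient3_abs_rep Quotient3_padic)
  have "padic_cauchy TYPE('p) (seq_of X)"
    using seq_of[of X] by simp
  note cau = this
  obtain M where M: "\<And>m n. m \<ge> M \<Longrightarrow> n \<ge> M \<Longrightarrow> qnorm TYPE('p) (seq_of X m - seq_of X n) < e / 2"
    by (rule padic_cauchyE[OF cau half_gt_zero[OF assms]]) (rule that, blast)
  define r where "r = seq_of X M"
  have "padic_norm (x - of_rat r) = norm_seq (X - const_seq r)"
    by (simp add: X of_rat_padic minus_padic.abs_eq padic_norm.abs_eq)
  also have "\<dots> \<le> e / 2"
    using M[of _ M]
    by (intro LIMSEQ_le_const2[OF norm_seq_LIMSEQ])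
       (auto simp: minus_padic_seq.rep_eq const_seq.rep_eq r_def intro!: exI[of _ M] less_imp_le)
  also have "\<dots> < e"
    using assms by simp
  finally show ?thesis
    using that by blast
qed

instance padic :: (prime_card) complete_space
proof
  fix u :: "nat \<Rightarrow> 'a padic"
  assume u: "Cauchy u"
  have "\<exists>r. padic_norm (u n - of_rat r) < 1 / real (Suc n)" for n
    by (rule padic_rat_dense[of "1 / real (Suc n)" "u n"]) auto
  then obtain R where R: "\<And>n. padic_norm (u n - of_rat (R n)) < 1 / real (Suc n)"
    by metis
  have small: "\<exists>N. \<forall>n\<ge>N. padic_norm (u n - of_rat (R n)) < e" if "e > 0" for e
  proof -
    obtain N where N: "1 / real (Suc N) < e"
      using \<open>e > 0\<close> nat_approx_posE by auto
    have "padic_norm (u n - of_rat (R n)) < e" if "n \<ge> N" for n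
    proof -
      have "1 / real (Suc n) \<le> 1 / real (Suc N)"
        using that by (simp add: frac_le)
      with R[of n] N show ?thesis by linarith
    qed
    then show ?thesis by blast
  qed
  have cau: "padic_cauchy TYPE('a) R"
    unfolding padic_cauchy_def
  proof (intro allI impI)
    fix e :: real assume e: "e > 0"
    obtain N where N: "\<And>n. n \<ge> N \<Longrightarrow> padic_norm (u n - of_rat (R n)) < e"
      using small[OF e] by blast
    obtain M where M: "\<And>m n. m \<ge> M \<Longrightarrow> n \<ge> M \<Longrightarrow> dist (u m) (u n) < e"
      using metric_CauchyD[OF u e] by blast
    have "qnorm TYPE('a) (R m - R n) < e" if mn: "m \<ge> max M N" "n \<ge> max M N" for m n
    proof -
      have "(of_rat (R m - R n) :: 'a padic)
          = - (u m - of_rat (R m)) + ((u m - u n) + (u n - of_rat (R n)))"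
        by (simp add: of_rat_diff)
      then have "padic_norm (of_rat (R m - R n) :: 'a padic)
          \<le> max (padic_norm (u m - of_rat (R m))) (padic_norm ((u m - u n) + (u n - of_rat (R n))))"
        by (metis padic_norm_add padic_norm_minus)
      also have "\<dots> \<le> max (padic_norm (u m - of_rat (R m)))
          (max (padic_norm (u m - u n)) (padic_norm (u n - of_rat (R n))))"
        by (intro max.mono order.refl padic_norm_add)
      also have "\<dots> < e"
        using N[of m] N[of n] M[of m n] mn by (simp add: dist_padic_def)
      finally show ?thesis
        by (simp add: norm_of_rat_padic)
    qed
    then show "\<exists>M. \<forall>m\<ge>M. \<forall>n\<ge>M. qnorm TYPE('a) (R m - R n) < e"
      by blast
  qed
  define l where "l = abs_padic (Padic_Seq R :: 'a padic_seq)"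
  have "u \<longlonglongrightarrow> l"
  proof (rule metric_LIMSEQ_I)
    fix e :: real assume e: "e > 0"
    obtain N where N: "\<And>n. n \<ge> N \<Longrightarrow> padic_norm (u n - of_rat (R n)) < e"
      using small[OF e] by blast
    have "e / 2 > 0" using e by simp
    obtain M where M: "\<And>m n. m \<ge> M \<Longrightarrow> n \<ge> M \<Longrightarrow> qnorm TYPE('a) (R m - R n) < e / 2"
      by (rule padic_cauchyE[OF cau \<open>e / 2 > 0\<close>]) (rule that, blast)
    have "dist (u n) l < e" if n: "n \<ge> max M N" for n
    proof -
      have "padic_norm (of_rat (R n) - l) = norm_seq (const_seq (R n) - Padic_Seq R :: 'a padic_seq)"
        by (simp add: l_def of_rat_padic minus_padic.abs_eq padic_norm.abs_eq)
      also have "\<dots> \<le> e / 2"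
        using M[of n] n cau
        by (intro LIMSEQ_le_const2[OF norm_seq_LIMSEQ])
           (auto simp: minus_padic_seq.rep_eq const_seq.rep_eq Padic_Seq_inverse intro!: exI[of _ M] less_imp_le)
      finally have "padic_norm (of_rat (R n) - l) < e"
        using e by simp
      moreover have "padic_norm (u n - of_rat (R n)) < e"
        using N n by simp
      ultimately have "max (padic_norm (u n - of_rat (R n))) (padic_norm (of_rat (R n) - l)) < e"
        by simp
      then show ?thesis
        using padic_norm_add[of "u n - of_rat (R n)" "of_rat (R n) - l"]
        by (auto simp: dist_padic_def le_max_iff_disj)
    qed
    then show "\<exists>N. \<forall>n\<ge>N. dist (u n) l < e"
      by blast
  qed
  then show "convergent u"
    by (auto simp: convergent_def)
qed

definition padic_val :: "'p::prime_card padic \<Rightarrow> ereal" where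
  "padic_val x = (if x = 0 then \<infinity> else ereal (- log (real CARD('p)) (padic_norm x)))"

lemma padic_val_p: "padic_val (of_nat CARD('p) :: 'p::prime_card padic) = 1"
proof -
  have "real CARD('p) > 1"
    using prime_gt_1_nat[OF prime_card[where 'a = 'p]] by simp
  then show ?thesis
    by (simp only: padic_val_def padic_norm_p of_nat_eq_0_iff) (simp add: log_divide)
qed

definition padic_integers :: "'p::prime_card padic set" where
  "padic_integers = {x. padic_norm x \<le> 1}"


section \<open>Dirichlet characters and generalized Bernoulli numbers\<close>

definition dirichlet_char :: "nat \<Rightarrow> (int \<Rightarrow> 'a::field) \<Rightarrow> bool" where
  "dirichlet_char N chi \<longleftrightarrow> N > 0 \<and> (\<forall>a. chi (a + int N) = chi a) \<and>
     (\<forall>a b. chi (a * b) = chi a * chi b) \<and> (\<forall>a. chi a \<noteq> 0 \<longleftrightarrow> coprime a (int N))"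

text \<open>The least modulus of a character inducing the given one.\<close>

definition conductor :: "(int \<Rightarrow> 'a::field) \<Rightarrow> nat" where
  "conductor chi = (LEAST f. \<exists>\<psi>. dirichlet_char f \<psi> \<and> (\<forall>a. chi a \<noteq> 0 \<longrightarrow> \<psi> a = chi a))"

definition primitive_char :: "(int \<Rightarrow> 'a::field) \<Rightarrow> int \<Rightarrow> 'a" where
  "primitive_char chi =
     (THE \<psi>. dirichlet_char (conductor chi) \<psi> \<and> (\<forall>a. chi a \<noteq> 0 \<longrightarrow> \<psi> a = chi a))"

text \<open>For a primitive character of conductor f, the generating function is
  \<open>\<Sum>a=1..f. chi(a) X e^{aX} / (e^{fX} - 1) = \<Sum>k. B_{k,chi} X^k / k!\<close>.\<close>

definition gen_bernoulli :: "nat \<Rightarrow> (int \<Rightarrow> 'a::field_char_0) \<Rightarrow> 'a" where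
  "gen_bernoulli k chi = fact k * fps_nth
     ((\<Sum>a=1..conductor chi. fps_const (chi (int a)) * fps_X * fps_exp (of_nat a))
        / (fps_exp (of_nat (conductor chi)) - 1)) k"


section \<open>The Kubota--Leopoldt p-adic L-function\<close>

text \<open>This is the Teichmueller character for odd p only; for p = 2 it would
  have to be taken modulo 4.\<close>

definition teichmueller :: "int \<Rightarrow> 'p::prime_card padic" where
  "teichmueller a =
     (if int CARD('p) dvd a then 0
      else (THE x. x ^ (CARD('p) - 1) = 1 \<and> padic_norm (x - of_int a) < 1))"

text \<open>Products of characters are to be read as primitive characters. The condition determines
  \<open>L\<close> because the points \<open>1 - k\<close> are dense in the p-adic integers; outside of its domain \<open>L\<close> is
  set to 0 to make it unique as a total function. Characters take values in the p-adic numbers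
  themselves, which is the case for the powers of the Teichmueller character.\<close>

definition is_padic_L ::
  "(int \<Rightarrow> 'p::prime_card padic) \<Rightarrow> ('p padic \<Rightarrow> 'p padic) \<Rightarrow> bool" where
  "is_padic_L chi L \<longleftrightarrow>
     continuous_on (padic_integers - {1}) L \<and>
     (\<forall>s. s \<notin> padic_integers - {1} \<longrightarrow> L s = 0) \<and>
     (\<forall>k\<ge>1. let \<psi> = primitive_char (\<lambda>a. chi a * inverse (teichmueller a) ^ k) in
        L (1 - of_nat k) =
          - (1 - \<psi> (int CARD('p)) * of_nat CARD('p) ^ (k - 1)) * gen_bernoulli k \<psi> / of_nat k)"

text \<open>The value at 1 is the limit; it is only meaningful for nontrivial characters; for the trivial one
  there is a pole.\<close>

definition padic_L :: "'p::prime_card padic \<Rightarrow> (int \<Rightarrow> 'p padic) \<Rightarrow> 'p padic" where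
  "padic_L s chi = (let L = (THE L. is_padic_L chi L) in
     if s = 1 then Lim (at 1 within padic_integers) L else L s)"

definition padic_zeta :: "'p::prime_card padic \<Rightarrow> 'p padic" where
  "padic_zeta s = padic_L s (\<lambda>_. 1)"

end

theory Submission
  imports Defs "HOL-Number_Theory.Residue_Primitive_Roots"
begin

text \<open>
  Let \<open>\<omega>\<close> be the Teichmueller character and \<open>\<langle>a\<rangle> = a / \<omega>(a)\<close>, which is congruent to 1 modulo \<open>p\<close>.
  The \<open>p\<close>-adic \<open>L\<close>-function of \<open>\<chi> = \<omega>^{-K}\<close> comes from a formula of Washington: the number
  \<open>- j * L (1 - j)\<close>, which is prescribed for positive integers \<open>j\<close>, equals
  \<open>W(j) = (1/p) \<Sum>\<^sub>a \<omega>(a)^{-K} \<langle>a\<rangle>^j \<Sum>\<^sub>i (j choose i) B\<^sub>i (p/a)^i\<close>, where \<open>0 < a < p\<close>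
  (lemmas \<open>euler_factor_times_gen_bernoulli\<close> and \<open>washington_eq_partial\<close>). Since \<open>p * B\<^sub>i\<close> is \<open>p\<close>-integral
  (\<open>padic_norm_bern_le\<close>), the inner sum converges uniformly in \<open>j\<close>, and its partial sums are
  \<open>p\<close>-adically Lipschitz in \<open>j\<close>. So \<open>W\<close> is uniformly continuous for the \<open>p\<close>-adic distance
  (\<open>washington_uniformly_continuous\<close>) and extends to a continuous function \<open>g\<close> on the \<open>p\<close>-adic
  integers, and \<open>L s = g (1 - s) / (s - 1)\<close> is the only function with the interpolation property
  (\<open>is_padic_L_divide\<close>, \<open>is_padic_L_unique\<close>).

  For \<open>s = 1 + m\<close> and \<open>K = m\<close> this is \<open>g (- m) / m\<close>. The point \<open>- m\<close> is a limit of natural numbers \<open>j\<close>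
  that are congruent to \<open>- m\<close> modulo \<open>p - 1\<close>. For these, \<open>\<omega>(a)^{-m} \<langle>a\<rangle>^j\<close> is simply \<open>a ^ j\<close>, and, \<open>p\<close>
  being odd, \<open>p * W(j)\<close> is congruent to \<open>1 ^ j + \<dots> + (p - 1) ^ j\<close> modulo \<open>p\<close>. This sum is
  \<open>- 1\<close> modulo \<open>p\<close> if \<open>p - 1\<close> divides \<open>m\<close> and 0 otherwise. Hence \<open>L (1 + m)\<close> has absolute value exactly
  \<open>p / |m|\<close> in the first case, and at most \<open>1 / |m|\<close> in the second (\<open>padic_norm_padic_L\<close>).
  It remains to see how often \<open>p\<close> divides \<open>m\<close>.

  The zeta function takes part because the trivial character and the principal character modulo \<open>p\<close>
  have the same \<open>p\<close>-adic \<open>L\<close>-function (\<open>padic_zeta_eq_padic_L\<close>).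
\<close>

section \<open>The p-adic absolute value of integers and of differences of powers\<close>

lemma padic_norm_of_nat_le_1 [simp]: "padic_norm (of_nat n :: 'p::prime_card padic) \<le> 1"
proof (induction n)
  case (Suc n)
  then show ?case
    using padic_norm_add[of "1 :: 'p padic" "of_nat n"] by simp
qed simp

lemma padic_norm_of_int_le_1 [simp]: "padic_norm (of_int k :: 'p::prime_card padic) \<le> 1"
  by (cases k rule: int_cases2) simp_all

lemma padic_norm_diff_le: "padic_norm (x - y) \<le> max (padic_norm x) (padic_norm y)"
  for x y :: "'p::prime_card padic"
  using padic_norm_add[of x "- y"] by simp

lemma padic_norm_pos: "x \<noteq> 0 \<Longrightarrow> padic_norm x > 0"
  by (metis order.not_eq_order_implies_strict padic_norm_eq_0 padic_norm_ge_0)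

lemma padic_norm_add_le: "padic_norm x \<le> B \<Longrightarrow> padic_norm y \<le> B \<Longrightarrow> padic_norm (x + y) \<le> B"
  for x y :: "'p::prime_card padic"
  using padic_norm_add[of x y] by linarith

lemma padic_norm_sum_le:
  fixes f :: "'b \<Rightarrow> 'p::prime_card padic"
  assumes "\<And>i. i \<in> A \<Longrightarrow> padic_norm (f i) \<le> B" "B \<ge> 0"
  shows "padic_norm (sum f A) \<le> B"
  using assms by (induction A rule: infinite_finite_induct) (auto intro!: padic_norm_add_le)

lemma padic_norm_divide: "padic_norm (x / y) = padic_norm x / padic_norm y"
  for x y :: "'p::prime_card padic"
  by (simp add: divide_inverse padic_norm_mult padic_norm_inverse)

lemma padic_norm_eq_if_close:
  fixes x y :: "'p::prime_card padic"
  assumes "padic_norm (x - y) < padic_norm y"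
  shows "padic_norm x = padic_norm y"
proof -
  have "padic_norm x \<le> max (padic_norm (x - y)) (padic_norm y)"
    using padic_norm_add[of "x - y" y] by simp
  moreover have "padic_norm y \<le> max (padic_norm (x - y)) (padic_norm x)"
    using padic_norm_diff_le[of x "x - y"] by simp
  ultimately show ?thesis using assms by linarith
qed

lemma padic_norm_power_le_1: "padic_norm x \<le> 1 \<Longrightarrow> padic_norm (x ^ n) \<le> 1"
  for x :: "'p::prime_card padic"
  by (simp add: padic_norm_power power_le_one)

lemma padic_norm_mult_le_1: "padic_norm x \<le> 1 \<Longrightarrow> padic_norm y \<le> B \<Longrightarrow> padic_norm (x * y) \<le> B"
  for x y :: "'p::prime_card padic"
  using mult_mono[of "padic_norm x" 1 "padic_norm y" B] by (simp add: padic_norm_mult)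

lemma card_prime_gt_1: "CARD('p::prime_card) > 1"
  using prime_card prime_gt_1_nat by blast

lemma inverse_power_card_le_1: "1 / real CARD('p::prime_card) ^ k \<le> 1"
  using card_prime_gt_1[where 'p = 'p] by simp

lemma padic_arch:
  assumes "e > 0"
  shows "\<exists>n. C / real CARD('p::prime_card) ^ n < e"
proof -
  have p1: "1 < real CARD('p)"
    using card_prime_gt_1[where 'p = 'p] by simp
  obtain n where "C / e < real CARD('p) ^ n"
    using real_arch_pow[OF p1] by blast
  then have "C / real CARD('p) ^ n < e"
    using assms p1 by (simp add: field_simps)
  then show ?thesis ..
qed

lemma multiplicity_of_nat_int:
  assumes "prime p" "n > 0"
  shows "multiplicity (int p) (int n) = multiplicity p n"
proof (rule multiplicity_eqI)
  have "\<not> is_unit p" using assms(1) not_prime_unit by blast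
  then have "\<not> p ^ Suc (multiplicity p n) dvd n"
    using assms(2) by (subst power_dvd_iff_le_multiplicity) auto
  then show "\<not> int p ^ Suc (multiplicity p n) dvd int n"
    unfolding of_nat_power[symmetric] int_dvd_int_iff .
  show "int p ^ multiplicity p n dvd int n"
    unfolding of_nat_power[symmetric] int_dvd_int_iff by (rule multiplicity_dvd)
qed

lemma padic_norm_of_nat:
  assumes "n > 0"
  shows "padic_norm (of_nat n :: 'p::prime_card padic) = 1 / real CARD('p) ^ multiplicity CARD('p) n"
  using assms rat_padic_norm_frac[OF prime_card[where 'a='p], of "int n" 1]
  by (simp add: norm_of_nat_padic power_int_minus divide_inverse multiplicity_of_nat_int prime_card)

lemma padic_norm_of_nat_eq_1_iff:
  "padic_norm (of_nat n :: 'p::prime_card padic) = 1 \<longleftrightarrow> \<not> CARD('p) dvd n"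
proof (cases "n = 0")
  case False
  have "real CARD('p) ^ k = 1 \<longleftrightarrow> k = 0" for k :: nat
  proof (cases k)
    case (Suc i)
    then have "real CARD('p) ^ k > 1"
      using card_prime_gt_1[where 'p = 'p] by (intro one_less_power) auto
    with Suc show ?thesis by simp
  qed simp
  moreover have "multiplicity CARD('p) n = 0 \<longleftrightarrow> \<not> CARD('p) dvd n"
    using False card_prime_gt_1[where 'p='p] by (intro multiplicity_eq_zero_iff) auto
  ultimately show ?thesis
    using False by (simp add: padic_norm_of_nat)
qed simp

lemma padic_norm_of_nat_dvd:
  assumes "CARD('p) ^ k dvd n"
  shows "padic_norm (of_nat n :: 'p::prime_card padic) \<le> 1 / real CARD('p) ^ k"
proof -
  obtain m where "n = CARD('p) ^ k * m" using assms by blast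
  then have "padic_norm (of_nat n :: 'p padic) = (1 / real CARD('p)) ^ k * padic_norm (of_nat m :: 'p padic)"
    by (simp add: padic_norm_mult padic_norm_power padic_norm_p)
  also have "\<dots> \<le> (1 / real CARD('p)) ^ k * 1"
    by (intro mult_left_mono) auto
  finally show ?thesis by (simp add: power_divide)
qed

lemma padic_norm_of_int_dvd:
  assumes "int CARD('p) ^ k dvd n"
  shows "padic_norm (of_int n :: 'p::prime_card padic) \<le> 1 / real CARD('p) ^ k"
proof -
  have "int (CARD('p) ^ k) dvd int (nat \<bar>n\<bar>)"
    using assms by simp
  then have "CARD('p) ^ k dvd nat \<bar>n\<bar>"
    by (simp only: int_dvd_int_iff)
  then have "padic_norm (of_nat (nat \<bar>n\<bar>) :: 'p padic) \<le> 1 / real CARD('p) ^ k"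
    by (rule padic_norm_of_nat_dvd)
  then show ?thesis by (cases "n \<ge> 0") simp_all
qed

lemma padic_norm_of_int_eq_1:
  assumes "\<not> int CARD('p) dvd n"
  shows "padic_norm (of_int n :: 'p::prime_card padic) = 1"
proof -
  have "\<not> int CARD('p) dvd int (nat \<bar>n\<bar>)"
    using assms by simp
  then have "\<not> CARD('p) dvd nat \<bar>n\<bar>"
    by (simp only: int_dvd_int_iff not_False_eq_True)
  then have "padic_norm (of_nat (nat \<bar>n\<bar>) :: 'p padic) = 1"
    by (simp only: padic_norm_of_nat_eq_1_iff) simp
  then show ?thesis by (cases "n \<ge> 0") simp_all
qed

lemma padic_norm_of_nat_ge:
  assumes "n > 0" "n < CARD('p) ^ Suc k"
  shows "padic_norm (of_nat n :: 'p::prime_card padic) \<ge> 1 / real CARD('p) ^ k"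
proof -
  have "CARD('p) ^ multiplicity CARD('p) n \<le> n"
    using assms(1) by (intro dvd_imp_le multiplicity_dvd)
  then have "CARD('p) ^ multiplicity CARD('p) n < CARD('p) ^ Suc k"
    using assms by linarith
  then have "multiplicity CARD('p) n \<le> k"
    using card_prime_gt_1[where 'p = 'p] by (simp only: power_strict_increasing_iff less_Suc_eq_le)
  then have "real CARD('p) ^ multiplicity CARD('p) n \<le> real CARD('p) ^ k"
    using card_prime_gt_1[where 'p = 'p] by (intro power_increasing) auto
  then show ?thesis
    using assms card_prime_gt_1[where 'p = 'p] by (simp add: padic_norm_of_nat frac_le)
qed

lemma padic_norm_power_diff_le:
  fixes x y :: "'p::prime_card padic"
  assumes "padic_norm x \<le> 1" "padic_norm y \<le> 1"
  shows "padic_norm (x ^ n - y ^ n) \<le> padic_norm (x - y)"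
proof -
  have "padic_norm (\<Sum>i<n. y ^ (n - Suc i) * x ^ i) \<le> 1"
    using assms by (intro padic_norm_sum_le padic_norm_mult_le_1 padic_norm_power_le_1) auto
  then show ?thesis
    by (subst power_diff_sumr2) (simp add: padic_norm_mult mult_left_le)
qed

text \<open>In the quotient \<open>(x ^ n - y ^ n) / (x - y)\<close> every power of \<open>x\<close> may be replaced by the same
  power of \<open>y\<close> at the cost of an error of size \<open>|x - y|\<close>. If \<open>x\<close> and \<open>y\<close> are units that are congruent
  modulo \<open>p\<close>, the quotient is therefore divisible by \<open>p\<close> for \<open>n = p\<close>, so that \<open>p\<close>-th powers come
  closer together, and it is a unit for \<open>n = p - 1\<close>, so that roots of unity stay apart.\<close>

lemma padic_norm_geometric_factor:
  fixes x y :: "'p::prime_card padic"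
  assumes "padic_norm x \<le> 1" "padic_norm y \<le> 1"
  shows "padic_norm ((\<Sum>i<n. y ^ (n - Suc i) * x ^ i) - of_nat n * y ^ (n - 1)) \<le> padic_norm (x - y)"
proof -
  have "(\<Sum>i<n. y ^ (n - Suc i) * x ^ i) - of_nat n * y ^ (n - 1)
      = (\<Sum>i<n. y ^ (n - Suc i) * (x ^ i - y ^ i))"
  proof -
    have "y ^ (n - Suc i) * y ^ i = y ^ (n - 1)" if "i < n" for i
      using that by (simp flip: power_add)
    then have "of_nat n * y ^ (n - 1) = (\<Sum>i<n. y ^ (n - Suc i) * y ^ i)"
      by simp
    then show ?thesis by (simp add: sum_subtractf right_diff_distrib)
  qed
  moreover have "padic_norm (\<Sum>i<n. y ^ (n - Suc i) * (x ^ i - y ^ i)) \<le> padic_norm (x - y)"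
    using assms
    by (intro padic_norm_sum_le padic_norm_mult_le_1 padic_norm_power_le_1 padic_norm_power_diff_le) auto
  ultimately show ?thesis by simp
qed

lemma padic_norm_pth_power_diff_le:
  fixes x y :: "'p::prime_card padic"
  assumes "padic_norm x \<le> 1" "padic_norm y \<le> 1" "padic_norm (x - y) \<le> 1 / real CARD('p)"
  shows "padic_norm (x ^ CARD('p) - y ^ CARD('p)) \<le> padic_norm (x - y) / real CARD('p)"
proof -
  let ?S = "\<Sum>i<CARD('p). y ^ (CARD('p) - Suc i) * x ^ i"
  have "padic_norm (of_nat CARD('p) * y ^ (CARD('p) - 1)) \<le> 1 / real CARD('p)"
    unfolding mult.commute[of "of_nat CARD('p)"]
    using assms by (intro padic_norm_mult_le_1 padic_norm_power_le_1) (simp_all only: padic_norm_p)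
  moreover have "padic_norm (?S - of_nat CARD('p) * y ^ (CARD('p) - 1)) \<le> 1 / real CARD('p)"
    using padic_norm_geometric_factor[OF assms(1,2), of "CARD('p)"] assms(3) by linarith
  ultimately have "padic_norm ((?S - of_nat CARD('p) * y ^ (CARD('p) - 1)) + of_nat CARD('p) * y ^ (CARD('p) - 1))
        \<le> 1 / real CARD('p)"
    by (rule padic_norm_add_le[rotated])
  then have "padic_norm ?S \<le> 1 / real CARD('p)"
    by simp
  then have "padic_norm (x - y) * padic_norm ?S \<le> padic_norm (x - y) * (1 / real CARD('p))"
    by (intro mult_left_mono) auto
  then show ?thesis
    by (subst power_diff_sumr2) (simp add: padic_norm_mult)
qed

text \<open>Only the factors \<open>p\<close> of \<open>n\<close> bring \<open>x ^ n\<close> closer to 1, and each of them does so by a factor of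
  at least \<open>p\<close>. It follows that \<open>j \<mapsto> x ^ j\<close> is Lipschitz for the \<open>p\<close>-adic distance of the exponents.\<close>

lemma padic_norm_one_unit_power:
  fixes x :: "'p::prime_card padic"
  assumes "padic_norm (x - 1) \<le> 1 / real CARD('p)"
  shows "padic_norm (x ^ n - 1) \<le> padic_norm (of_nat n :: 'p padic) * padic_norm (x - 1)"
  using assms
proof (induction n arbitrary: x rule: less_induct)
  case (less n)
  have le1: "1 / real CARD('p) \<le> 1"
    using card_prime_gt_1[where 'p = 'p] by simp
  have x: "padic_norm x \<le> 1"
    using padic_norm_add_le[OF order.trans[OF less.prems le1], of 1] by simp
  show ?case
  proof (cases "n = 0")
    case n: False
    show ?thesis
    proof (cases "CARD('p) dvd n")
      case True
      then obtain m where m: "n = CARD('p) * m" by blast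
      with n card_prime_gt_1[where 'p = 'p] have "m < n" by simp
      have step: "padic_norm (x ^ CARD('p) - 1) \<le> padic_norm (x - 1) / real CARD('p)"
        using padic_norm_pth_power_diff_le[of x 1] x less.prems by simp
      also have "\<dots> \<le> 1 / real CARD('p)"
        by (intro divide_right_mono order.trans[OF less.prems le1]) auto
      finally have "padic_norm ((x ^ CARD('p)) ^ m - 1)
          \<le> padic_norm (of_nat m :: 'p padic) * padic_norm (x ^ CARD('p) - 1)"
        by (rule less.IH[OF \<open>m < n\<close>])
      also have "\<dots> \<le> padic_norm (of_nat m :: 'p padic) * (padic_norm (x - 1) / real CARD('p))"
        by (intro mult_left_mono step) auto
      also have "\<dots> = padic_norm (of_nat n :: 'p padic) * padic_norm (x - 1)"
        by (simp add: m padic_norm_mult padic_norm_p)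
      finally show ?thesis by (simp add: m power_mult)
    next
      case False
      then have "padic_norm (of_nat n :: 'p padic) = 1"
        by (simp add: padic_norm_of_nat_eq_1_iff)
      then show ?thesis
        using padic_norm_power_diff_le[of x 1 n] x by simp
    qed
  qed simp
qed

section \<open>Existence and multiplicativity of Teichmueller representatives\<close>

lemma padic_norm_eq_1_if_power_eq_1:
  fixes x :: "'p::prime_card padic"
  assumes "x ^ n = 1" "n > 0"
  shows "padic_norm x = 1"
proof -
  have "padic_norm x ^ n = 1"
    using assms(1) by (metis padic_norm_1 padic_norm_power)
  then show ?thesis
    using assms(2) by (metis padic_norm_ge_0 power_eq_imp_eq_base power_one zero_le_one)
qed

text \<open>If \<open>x \<noteq> y\<close>, then the cofactor of \<open>x - y\<close> in \<open>x ^ (p - 1) - y ^ (p - 1) = 0\<close> vanishes; but it is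
  congruent to \<open>(p - 1) * y ^ (p - 2)\<close>, which is a unit.\<close>

lemma root_of_unity_unique:
  fixes x y :: "'p::prime_card padic"
  assumes x: "x ^ (CARD('p) - 1) = 1" and y: "y ^ (CARD('p) - 1) = 1" and xy: "padic_norm (x - y) < 1"
  shows "x = y"
proof (rule ccontr)
  assume "x \<noteq> y"
  let ?n = "CARD('p) - 1"
  let ?S = "\<Sum>i<?n. y ^ (?n - Suc i) * x ^ i"
  have n: "?n > 0"
    using card_prime_gt_1[where 'p = 'p] by simp
  have 1: "padic_norm x = 1" "padic_norm y = 1"
    using x y n by (blast intro: padic_norm_eq_1_if_power_eq_1)+
  have "(x - y) * ?S = 0"
    by (simp only: power_diff_sumr2[symmetric] x y diff_self)
  with \<open>x \<noteq> y\<close> have "?S = 0" by simp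
  moreover have "padic_norm (?S - of_nat ?n * y ^ (?n - 1)) \<le> padic_norm (x - y)"
    using 1 by (intro padic_norm_geometric_factor) auto
  ultimately have "padic_norm (of_nat ?n * y ^ (?n - 1)) < 1"
    using xy by (simp del: of_nat_diff)
  moreover have "\<not> CARD('p) dvd ?n"
    using n by (auto dest: dvd_imp_le)
  then have "padic_norm (of_nat ?n :: 'p padic) = 1"
    by (simp only: padic_norm_of_nat_eq_1_iff) simp
  ultimately show False
    using 1 by (simp only: padic_norm_mult padic_norm_power) simp
qed

lemma fermat_int:
  assumes "prime p" "\<not> int p dvd a"
  shows "int p dvd a ^ (p - 1) - 1"
proof -
  define b where "b = nat (a mod int p)"
  have b: "int b = a mod int p"
    using assms(1) prime_gt_0_nat by (simp add: b_def)
  have "\<not> p dvd b"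
    using assms(2) b by (metis dvd_mod_iff dvd_refl int_dvd_int_iff)
  then have "[b ^ (p - 1) = 1] (mod p)"
    using assms(1) by (rule fermat_theorem[rotated])
  then have "[int b ^ (p - 1) = 1] (mod int p)"
    by (metis cong_int_iff of_nat_1 of_nat_power)
  then have "[a ^ (p - 1) = 1] (mod int p)"
    by (simp add: b cong_def power_mod)
  then show ?thesis
    by (simp add: cong_iff_dvd_diff)
qed

text \<open>The root of unity is the limit of \<open>a ^ (p ^ n)\<close>. By Fermat's little theorem \<open>a ^ p\<close> is congruent
  to \<open>a\<close>, and every further \<open>p\<close>-th power gains a factor \<open>p\<close>, so the sequence is Cauchy and stays
  congruent to \<open>a\<close>; its \<open>(p - 1)\<close>-st powers tend to 1 for the same reason.\<close>

lemma teichmueller_exists: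
  assumes "\<not> int CARD('p::prime_card) dvd a"
  shows "\<exists>x :: 'p padic. x ^ (CARD('p) - 1) = 1 \<and> padic_norm (x - of_int a) \<le> 1 / real CARD('p)"
proof -
  let ?p = "CARD('p)"
  note p1 = card_prime_gt_1[where 'p = 'p]
  define u where "u n = (of_int a :: 'p padic) ^ (?p ^ n)" for n
  have u_norm: "padic_norm (u n) \<le> 1" for n
    by (simp add: u_def padic_norm_power_le_1)
  have fermat: "padic_norm (of_int a ^ (?p - 1) - 1 :: 'p padic) \<le> 1 / real ?p"
    using padic_norm_of_int_dvd[of 1 "a ^ (?p - 1) - 1", where 'p = 'p]
      fermat_int[OF prime_card assms] by simp
  have step: "padic_norm (u (Suc n) - u n) \<le> 1 / real ?p ^ Suc n" for n
  proof (induction n)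
    case 0
    have "of_int a ^ ?p = of_int a * (of_int a :: 'p padic) ^ (?p - 1)"
      using p1 by (simp flip: power_Suc)
    then have "u (Suc 0) - u 0 = of_int a * (of_int a ^ (?p - 1) - 1)"
      by (simp add: u_def right_diff_distrib)
    then show ?case
      using fermat by (simp add: padic_norm_mult_le_1)
  next
    case (Suc n)
    have "1 / real ?p ^ Suc n \<le> 1 / real ?p"
      using inverse_power_card_le_1[of n, where 'p = 'p] p1 by (simp add: field_simps)
    then have "padic_norm (u (Suc n) ^ ?p - u n ^ ?p) \<le> padic_norm (u (Suc n) - u n) / real ?p"
      using Suc.IH u_norm by (intro padic_norm_pth_power_diff_le) auto
    also have "\<dots> \<le> (1 / real ?p ^ Suc n) / real ?p"
      using Suc.IH by (intro divide_right_mono) auto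
    finally show ?case
      by (simp add: u_def mult_ac flip: power_mult)
  qed
  have far: "padic_norm (u n - u m) \<le> 1 / real ?p ^ Suc n" if "n \<le> m" for n m
    using that
  proof (induction m rule: dec_induct)
    case (step m)
    have "1 / real ?p ^ Suc m \<le> 1 / real ?p ^ Suc n"
      using step.hyps p1 by (intro divide_left_mono power_increasing) auto
    then have "padic_norm (u m - u (Suc m)) \<le> 1 / real ?p ^ Suc n"
      using \<open>\<And>n. padic_norm (u (Suc n) - u n) \<le> 1 / real ?p ^ Suc n\<close>[of m]
      by (simp add: padic_norm_diff_commute)
    from padic_norm_add_le[OF step.IH this] show ?case by simp
  qed simp
  have small: "\<exists>n. 1 / real ?p ^ Suc n < e" if "e > 0" for e
  proof -
    have "\<exists>n. (1 / real ?p) ^ n < e"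
      using that p1 by (intro real_arch_pow_inv) auto
    then obtain n where "(1 / real ?p) ^ n < e" by blast
    moreover have "(1 / real ?p) ^ Suc n \<le> (1 / real ?p) ^ n"
      using p1 by (intro power_decreasing) auto
    ultimately have "(1 / real ?p) ^ Suc n < e" by linarith
    then show ?thesis by (auto simp: power_divide)
  qed
  have "Cauchy u"
  proof (rule CauchyI')
    fix e :: real assume "e > 0"
    from small[OF this] obtain n where n: "1 / real ?p ^ Suc n < e" by blast
    have "dist (u i) (u j) < e" if "i \<ge> n" "j > i" for i j
    proof -
      have "dist (u i) (u j) \<le> 1 / real ?p ^ Suc i"
        using far[of i j] that by (simp add: dist_padic_def)
      also have "\<dots> \<le> 1 / real ?p ^ Suc n"
        using that p1 by (intro divide_left_mono power_increasing) auto
      finally show ?thesis using n by linarith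
    qed
    then show "\<exists>M. \<forall>m\<ge>M. \<forall>n>m. dist (u m) (u n) < e" by blast
  qed
  then obtain x where x: "u \<longlonglongrightarrow> x"
    using Cauchy_convergent convergent_def by blast
  have close: "padic_norm (u n - x) \<le> 1 / real ?p ^ Suc n" for n
    using Lim_dist_ubound[OF sequentially_bot x, of "u n" "1 / real ?p ^ Suc n"] far[of n]
    by (auto simp: dist_padic_def eventually_sequentially)
  have x_norm: "padic_norm x \<le> 1"
    using padic_norm_diff_le[of "u 0" "u 0 - x"] order.trans[OF close[of 0] inverse_power_card_le_1]
      u_norm[of 0] by simp
  have "padic_norm (x ^ (?p - 1) - 1) \<le> 0"
  proof (rule ccontr)
    assume "\<not> ?thesis"
    then obtain n where n: "1 / real ?p ^ Suc n < padic_norm (x ^ (?p - 1) - 1)"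
      using small[of "padic_norm (x ^ (?p - 1) - 1)"] by auto
    have "padic_norm (x ^ (?p - 1) - u n ^ (?p - 1)) \<le> padic_norm (x - u n)"
      by (intro padic_norm_power_diff_le x_norm u_norm)
    then have 1: "padic_norm (x ^ (?p - 1) - u n ^ (?p - 1)) \<le> 1 / real ?p ^ Suc n"
      using close[of n] by (simp add: padic_norm_diff_commute)
    have "padic_norm ((of_int a ^ (?p - 1)) ^ (?p ^ n) - 1 :: 'p padic)
        \<le> padic_norm (of_nat (?p ^ n) :: 'p padic) * padic_norm (of_int a ^ (?p - 1) - 1 :: 'p padic)"
      by (rule padic_norm_one_unit_power[OF fermat])
    also have "\<dots> \<le> (1 / real ?p ^ n) * (1 / real ?p)"
      by (intro mult_mono padic_norm_of_nat_dvd fermat) auto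
    finally have "padic_norm (u n ^ (?p - 1) - 1) \<le> 1 / real ?p ^ Suc n"
      by (simp add: u_def mult_ac flip: power_mult)
    from padic_norm_add_le[OF 1 this] n show False by simp
  qed
  then have "x ^ (?p - 1) = 1"
    by (metis eq_iff_diff_eq_0 order.antisym padic_norm_eq_0 padic_norm_ge_0)
  moreover have "padic_norm (x - of_int a) \<le> 1 / real ?p"
    using close[of 0] by (simp add: u_def padic_norm_diff_commute)
  ultimately show ?thesis by blast
qed

lemma not_card_dvd_if_less: "a \<in> {1..<CARD('p)} \<Longrightarrow> \<not> CARD('p::prime_card) dvd a"
  by (auto dest: dvd_imp_le)

lemma teichmueller_eqI:
  fixes x :: "'p::prime_card padic"
  assumes "\<not> int CARD('p) dvd a" "x ^ (CARD('p) - 1) = 1" "padic_norm (x - of_int a) < 1"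
  shows "teichmueller a = x"
proof -
  have "(THE x :: 'p padic. x ^ (CARD('p) - 1) = 1 \<and> padic_norm (x - of_int a) < 1) = x"
  proof (rule the_equality)
    fix y :: "'p padic" assume y: "y ^ (CARD('p) - 1) = 1 \<and> padic_norm (y - of_int a) < 1"
    have "padic_norm (y - x) < 1"
      using padic_norm_diff_le[of "y - of_int a" "x - of_int a"] y assms(3) by auto
    with y show "y = x"
      using assms(2) root_of_unity_unique by blast
  qed (use assms in auto)
  then show ?thesis
    using assms(1) by (simp add: teichmueller_def)
qed

lemma teichmueller_dvd: "int CARD('p::prime_card) dvd a \<Longrightarrow> (teichmueller a :: 'p padic) = 0"
  by (simp add: teichmueller_def)

lemma
  assumes "\<not> int CARD('p::prime_card) dvd a"
  shows teichmueller_power: "(teichmueller a :: 'p padic) ^ (CARD('p) - 1) = 1"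
    and teichmueller_close: "padic_norm (teichmueller a - of_int a :: 'p padic) \<le> 1 / real CARD('p)"
proof -
  obtain x :: "'p padic" where x: "x ^ (CARD('p) - 1) = 1" "padic_norm (x - of_int a) \<le> 1 / real CARD('p)"
    using teichmueller_exists[OF assms] by blast
  have "1 / real CARD('p) < 1"
    using card_prime_gt_1[where 'p = 'p] by simp
  then have "teichmueller a = x"
    by (intro teichmueller_eqI assms x order.strict_trans1[OF x(2)])
  with x show "(teichmueller a :: 'p padic) ^ (CARD('p) - 1) = 1"
    "padic_norm (teichmueller a - of_int a :: 'p padic) \<le> 1 / real CARD('p)" by auto
qed

lemma teichmueller_power_dvd:
  assumes "\<not> int CARD('p) dvd a" "(CARD('p) - 1) dvd n"
  shows "(teichmueller a :: 'p::prime_card padic) ^ n = 1"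
proof -
  obtain m where "n = (CARD('p) - 1) * m" using assms(2) by blast
  then show ?thesis
    by (simp only: power_mult teichmueller_power[OF assms(1)] power_one)
qed

lemma norm_teichmueller:
  assumes "\<not> int CARD('p::prime_card) dvd a"
  shows "padic_norm (teichmueller a :: 'p padic) = 1"
  using teichmueller_power[OF assms] card_prime_gt_1[where 'p = 'p]
  by (intro padic_norm_eq_1_if_power_eq_1) auto

lemma teichmueller_eq_0_iff: "(teichmueller a :: 'p::prime_card padic) = 0 \<longleftrightarrow> int CARD('p) dvd a"
  using norm_teichmueller[of a, where 'p = 'p] teichmueller_dvd[of a, where 'p = 'p]
  by (metis padic_norm_0 zero_neq_one)

lemma teichmueller_mult:
  "(teichmueller (a * b) :: 'p::prime_card padic) = teichmueller a * teichmueller b"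
proof (cases "int CARD('p) dvd a * b")
  case True
  then have "int CARD('p) dvd a \<or> int CARD('p) dvd b"
    using prime_card_int[where 'a = 'p] by (simp add: prime_dvd_mult_iff)
  with True show ?thesis
    by (auto simp: teichmueller_dvd)
next
  case False
  then have ab: "\<not> int CARD('p) dvd a" "\<not> int CARD('p) dvd b"
    by auto
  let ?a = "teichmueller a :: 'p padic" and ?b = "teichmueller b :: 'p padic"
  have "?a * ?b - of_int (a * b) = ?a * (?b - of_int b) + of_int b * (?a - of_int a)"
    by (simp add: algebra_simps)
  also have "padic_norm \<dots> \<le> 1 / real CARD('p)"
    using ab by (intro padic_norm_add_le padic_norm_mult_le_1)
      (auto simp: teichmueller_close norm_teichmueller)
  also have "\<dots> < 1"
    using card_prime_gt_1[where 'p = 'p] by simp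
  finally show ?thesis
    using ab False by (intro teichmueller_eqI) (simp_all only: power_mult_distrib teichmueller_power not_False_eq_True mult_1)
qed

lemma teichmueller_cong:
  assumes "int CARD('p::prime_card) dvd a - b"
  shows "(teichmueller a :: 'p padic) = teichmueller b"
proof (cases "int CARD('p) dvd a")
  case True
  then have "int CARD('p) dvd b"
    using assms by (metis dvd_diff_right_iff)
  with True show ?thesis by (simp add: teichmueller_dvd)
next
  case False
  then have b: "\<not> int CARD('p) dvd b"
    using assms by (metis dvd_diff_left_iff)
  have "padic_norm (of_int (a - b) :: 'p padic) \<le> 1 / real CARD('p)"
    using padic_norm_of_int_dvd[of 1 "a - b", where 'p = 'p] assms by simp
  moreover have "padic_norm (teichmueller b - of_int b :: 'p padic) \<le> 1 / real CARD('p)"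
    by (rule teichmueller_close[OF b])
  ultimately have "padic_norm ((teichmueller b - of_int b) - of_int (a - b) :: 'p padic) \<le> 1 / real CARD('p)"
    using padic_norm_diff_le[of "teichmueller b - of_int b :: 'p padic" "of_int (a - b)"] by linarith
  also have "\<dots> < 1"
    using card_prime_gt_1[where 'p = 'p] by simp
  finally show ?thesis
    using False teichmueller_power[OF b] by (intro teichmueller_eqI) auto
qed

section \<open>Bernoulli numbers of periodic functions\<close>

text \<open>The power series \<open>(e^{cX} - 1) / X\<close>, which is invertible for \<open>c \<noteq> 0\<close>. Generating functions of
  Bernoulli numbers are products with its inverse.\<close>

definition exp_quot :: "'a::field_char_0 \<Rightarrow> 'a fps" where
  "exp_quot c = Abs_fps (\<lambda>n. c ^ Suc n / fact (Suc n))"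

text \<open>The Bernoulli numbers with \<open>B\<^sub>1 = -1/2\<close>.\<close>

definition bern :: "nat \<Rightarrow> 'a::field_char_0" where
  "bern n = fact n * fps_nth (inverse (exp_quot 1)) n"

lemma exp_quot_nth: "fps_nth (exp_quot c) n = c ^ Suc n / fact (Suc n)"
  by (simp add: exp_quot_def)

lemma fps_X_times_exp_quot: "fps_X * exp_quot c = fps_exp c - 1"
proof (rule fps_ext)
  show "fps_nth (fps_X * exp_quot c) n = fps_nth (fps_exp c - 1) n" for n
    by (cases n) (simp_all add: exp_quot_def del: fact_Suc)
qed

lemma inverse_exp_quot_1: "inverse (exp_quot 1) = Abs_fps (\<lambda>n. bern n / fact n)"
  by (rule fps_ext) (simp add: bern_def)

lemma exp_quot_0_nonzero: "c \<noteq> 0 \<Longrightarrow> fps_nth (exp_quot c) 0 \<noteq> 0"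
  by (simp add: exp_quot_def)

lemma inverse_exp_quot:
  fixes c :: "'a::field_char_0"
  assumes c: "c \<noteq> 0"
  shows "inverse (exp_quot c) = Abs_fps (\<lambda>n. bern n * c ^ n / fact n / c)"
proof -
  have one: "exp_quot (1::'a) * Abs_fps (\<lambda>n. bern n / fact n) = 1"
    using inverse_mult_eq_1'[of "exp_quot (1::'a)"] by (simp add: exp_quot_0_nonzero inverse_exp_quot_1)
  have "exp_quot c * Abs_fps (\<lambda>n. bern n * c ^ n / fact n / c) = 1"
  proof (rule fps_ext)
    fix n
    have "c ^ Suc i / fact (Suc i) * (bern (n - i) * c ^ (n - i) / fact (n - i) / c)
        = c ^ n * (1 / fact (Suc i) * (bern (n - i) / fact (n - i)))" if "i \<le> n" for i
    proof -
      have "c ^ Suc i * c ^ (n - i) = c ^ n * c"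
        using that by (simp flip: power_add)
      then show ?thesis using c by (simp add: field_simps del: fact_Suc)
    qed
    then have "fps_nth (exp_quot c * Abs_fps (\<lambda>n. bern n * c ^ n / fact n / c)) n
        = c ^ n * fps_nth (exp_quot 1 * Abs_fps (\<lambda>n. bern n / fact n)) n"
      by (simp add: fps_mult_nth exp_quot_def sum_distrib_left del: power_Suc fact_Suc)
    also have "\<dots> = fps_nth 1 n"
      unfolding one by simp
    finally show "fps_nth (exp_quot c * Abs_fps (\<lambda>n. bern n * c ^ n / fact n / c)) n = fps_nth 1 n" .
  qed
  then show ?thesis
    using c fps_inverse_unique exp_quot_0_nonzero by metis
qed

text \<open>A geometric series in \<open>e^X\<close>, in which the factor \<open>X\<close> of numerator and denominator is cancelled.\<close>

lemma sum_fps_exp: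
  "(\<Sum>a<n. fps_exp (of_nat a)) = exp_quot (of_nat n) * inverse (exp_quot (1::'a::field_char_0))"
proof -
  have exp_pow: "fps_exp (1::'a) ^ a = fps_exp (of_nat a)" for a
    by (simp add: fps_exp_power_mult)
  have "fps_exp (of_nat n) - 1 = (fps_exp (1::'a) - 1) * (\<Sum>a<n. fps_exp (of_nat a))"
    using power_diff_1_eq[of "fps_exp (1::'a)" n] by (simp add: exp_pow)
  then have "fps_X * exp_quot (of_nat n :: 'a) = fps_X * (exp_quot 1 * (\<Sum>a<n. fps_exp (of_nat a)))"
    by (simp only: fps_X_times_exp_quot[symmetric] mult.assoc)
  then have "exp_quot (of_nat n :: 'a) = exp_quot 1 * (\<Sum>a<n. fps_exp (of_nat a))"
    by simp
  moreover have "exp_quot (1::'a) * inverse (exp_quot 1) = 1"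
    by (intro inverse_mult_eq_1') (simp add: exp_quot_0_nonzero)
  ultimately show ?thesis
    by (simp add: mult_ac)
qed

lemma fact_binomial_div:
  "i \<le> n \<Longrightarrow> (fact n / (fact i * fact (n - i)) :: 'a::field_char_0) = of_nat (n choose i)"
  by (simp add: binomial_fact)

text \<open>Faulhaber's formula: compare coefficients of \<open>X ^ j\<close> in the geometric series.\<close>

lemma sum_powers_bern:
  "(\<Sum>a<n. of_nat a ^ j) =
     (\<Sum>i\<le>j. of_nat (j choose i) * bern (j - i) * of_nat n ^ Suc i / of_nat (Suc i) :: 'a::field_char_0)"
proof -
  have "(\<Sum>a<n. of_nat a ^ j :: 'a) = fact j * fps_nth (\<Sum>a<n. fps_exp (of_nat a)) j"
    by (simp add: fps_sum_nth sum_distrib_left)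
  also have "\<dots> = (\<Sum>i\<le>j. fact j * (of_nat n ^ Suc i / fact (Suc i) * (bern (j - i) / fact (j - i))))"
    by (simp add: sum_fps_exp inverse_exp_quot_1 fps_mult_nth exp_quot_nth sum_distrib_left atLeast0AtMost
        del: power_Suc fact_Suc)
  also have "\<dots> = (\<Sum>i\<le>j. of_nat (j choose i) * bern (j - i) * of_nat n ^ Suc i / of_nat (Suc i))"
  proof (rule sum.cong)
    fix i assume "i \<in> {..j}"
    then have "i \<le> j" by simp
    have "F * (A / (s * f) * (b / g)) = F / (f * g) * b * A / s" for F A s f b g :: 'a
      by (simp add: mult_ac)
    with \<open>i \<le> j\<close> show "fact j * (of_nat n ^ Suc i / fact (Suc i) * (bern (j - i) / fact (j - i)))
        = (of_nat (j choose i) * bern (j - i) * of_nat n ^ Suc i / of_nat (Suc i) :: 'a)"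
      by (simp only: fact_Suc fact_binomial_div[symmetric])
  qed simp
  finally show ?thesis .
qed

lemma bern_0 [simp]: "bern 0 = 1"
  by (simp add: bern_def exp_quot_def)

lemma bern_1: "bern (Suc 0) = (- 1 / 2 :: 'a::field_char_0)"
proof -
  have "bern (Suc 0) * 2 + 1 = (0 :: 'a)"
    using sum_powers_bern[of 1 1, where 'a = 'a] by (simp add: field_simps)
  then have "bern (Suc 0) * 2 = (- 1 :: 'a)"
    by (simp only: eq_neg_iff_add_eq_0)
  then show ?thesis
    by (subst nonzero_eq_divide_eq) simp_all
qed

text \<open>The generalized Bernoulli number of an \<open>n\<close>-periodic function \<open>u\<close>, in the form of
  \<open>n ^ (j - 1) * (\<Sum>a=1..n. u a * B_j(a / n))\<close> with the Bernoulli polynomial \<open>B_j\<close>. The period \<open>n\<close>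
  is a parameter since a character modulo \<open>p\<close> and the primitive character inducing it have to be
  compared.\<close>

definition twisted_bernoulli :: "nat \<Rightarrow> (nat \<Rightarrow> 'a::field_char_0) \<Rightarrow> nat \<Rightarrow> 'a" where
  "twisted_bernoulli n u j =
     (\<Sum>a=1..n. u a * (\<Sum>i\<le>j. of_nat (j choose i) * bern i * of_nat n ^ i * of_nat a ^ (j - i))) / of_nat n"

lemma fps_nth_exp_over_exp_quot:
  fixes c d :: "'a::field_char_0"
  assumes "c \<noteq> 0"
  shows "fact j * fps_nth (fps_exp d * inverse (exp_quot c)) j
       = (\<Sum>i\<le>j. of_nat (j choose i) * bern i * c ^ i * d ^ (j - i)) / c"
proof -
  have "fact j * fps_nth (inverse (exp_quot c) * fps_exp d) j
      = (\<Sum>i\<le>j. fact j * (bern i * c ^ i / fact i / c * (d ^ (j - i) / fact (j - i))))"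
    using assms by (simp add: inverse_exp_quot fps_mult_nth sum_distrib_left atLeast0AtMost)
  also have "\<dots> = (\<Sum>i\<le>j. of_nat (j choose i) * bern i * c ^ i * d ^ (j - i) / c)"
  proof (rule sum.cong)
    fix i assume "i \<in> {..j}"
    then have "i \<le> j" by simp
    then show "fact j * (bern i * c ^ i / fact i / c * (d ^ (j - i) / fact (j - i)))
        = of_nat (j choose i) * bern i * c ^ i * d ^ (j - i) / c"
      by (simp add: fact_binomial_div[symmetric] field_simps)
  qed simp
  finally show ?thesis
    by (simp add: sum_divide_distrib mult.commute)
qed

lemma twisted_bernoulli_eq_fps_nth:
  assumes "n > 0"
  shows "twisted_bernoulli n u j =
    fact j * fps_nth ((\<Sum>a=1..n. fps_const (u a) * fps_exp (of_nat a)) * inverse (exp_quot (of_nat n))) j"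
proof -
  have "fact j * fps_nth ((\<Sum>a=1..n. fps_const (u a) * fps_exp (of_nat a)) * inverse (exp_quot (of_nat n))) j
      = (\<Sum>a=1..n. u a * (fact j * fps_nth (fps_exp (of_nat a) * inverse (exp_quot (of_nat n))) j))"
    by (simp add: sum_distrib_right sum_distrib_left fps_sum_nth mult.assoc mult.left_commute)
  also have "\<dots> = twisted_bernoulli n u j"
    unfolding twisted_bernoulli_def sum_divide_distrib[of _ "{1..n}"]
    using assms by (simp add: fps_nth_exp_over_exp_quot)
  finally show ?thesis by simp
qed

lemma gen_bernoulli_eq_twisted_bernoulli:
  fixes chi :: "int \<Rightarrow> 'a::field_char_0"
  assumes "conductor chi > 0"
  shows "gen_bernoulli k chi = twisted_bernoulli (conductor chi) (\<lambda>a. chi (int a)) k"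
proof -
  let ?f = "conductor chi"
  let ?A = "\<Sum>a=1..?f. fps_const (chi (int a)) * fps_exp (of_nat a)"
  have f: "of_nat ?f \<noteq> (0 :: 'a)" using assms by simp
  have "(\<Sum>a=1..?f. fps_const (chi (int a)) * fps_X * fps_exp (of_nat a)) = fps_X * ?A"
    by (simp add: sum_distrib_left mult_ac)
  then have "(\<Sum>a=1..?f. fps_const (chi (int a)) * fps_X * fps_exp (of_nat a)) / (fps_exp (of_nat ?f) - 1)
      = (fps_X * ?A) / (fps_X * exp_quot (of_nat ?f))"
    by (simp add: fps_X_times_exp_quot)
  also have "\<dots> = ?A / exp_quot (of_nat ?f)"
    by (rule div_mult_mult1) simp
  also have "\<dots> = ?A * inverse (exp_quot (of_nat ?f))"
    using exp_quot_0_nonzero[OF f] by (rule fps_divide_unit)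
  finally show ?thesis
    using assms by (simp add: gen_bernoulli_def twisted_bernoulli_eq_fps_nth)
qed

text \<open>The constant function may be given any period: the sum over a period is a geometric series,
  which turns the denominator \<open>e^{nX} - 1\<close> into \<open>e^X - 1\<close>.\<close>

lemma twisted_bernoulli_const:
  assumes "n > 0"
  shows "twisted_bernoulli n (\<lambda>_. 1) k = (twisted_bernoulli 1 (\<lambda>_. 1) k :: 'a::field_char_0)"
proof -
  have n: "of_nat n \<noteq> (0::'a)" using assms by simp
  have "(\<Sum>a=1..n. fps_exp (of_nat a) :: 'a fps) = (\<Sum>a<n. fps_exp (of_nat (Suc a)))"
    by (rule sum.reindex_bij_witness[of _ Suc "\<lambda>a. a - 1"]) auto
  also have "\<dots> = fps_exp 1 * (\<Sum>a<n. fps_exp (of_nat a))"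
    by (simp add: sum_distrib_left fps_exp_add_mult)
  finally have "(\<Sum>a=1..n. fps_exp (of_nat a) :: 'a fps) * inverse (exp_quot (of_nat n))
      = fps_exp 1 * inverse (exp_quot 1) * (exp_quot (of_nat n) * inverse (exp_quot (of_nat n)))"
    by (simp add: sum_fps_exp mult_ac)
  also have "exp_quot (of_nat n) * inverse (exp_quot (of_nat n :: 'a)) = 1"
    by (rule inverse_mult_eq_1'[OF exp_quot_0_nonzero[OF n]])
  finally show ?thesis
    using assms by (simp add: twisted_bernoulli_eq_fps_nth)
qed

text \<open>Leaving out the multiples of \<open>n\<close> produces an Euler factor: the term for \<open>a = n\<close> has generating
  function \<open>X e^{nX} / (e^{nX} - 1)\<close>, which is that of the ordinary Bernoulli numbers
  (with \<open>B\<^sub>1 = 1/2\<close>) at \<open>nX\<close>, divided by \<open>n\<close>.\<close>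

lemma twisted_bernoulli_principal:
  assumes "n > 0" "k > 0"
  shows "twisted_bernoulli n (\<lambda>a. if a = n then 0 else 1) k
       = (1 - of_nat n ^ (k - 1)) * (twisted_bernoulli 1 (\<lambda>_. 1) k :: 'a::field_char_0)"
proof -
  let ?T = "\<lambda>a. (\<Sum>i\<le>k. of_nat (k choose i) * bern i * of_nat n ^ i * of_nat a ^ (k - i)) :: 'a"
  have "twisted_bernoulli n (\<lambda>a. if a = n then 0 else 1) k
      = (\<Sum>a=1..n. ?T a - (if a = n then ?T n else 0)) / of_nat n"
    unfolding twisted_bernoulli_def by (intro arg_cong2[where f = "(/)"] sum.cong) auto
  also have "\<dots> = twisted_bernoulli n (\<lambda>_. 1) k - ?T n / of_nat n"
    using assms by (simp add: twisted_bernoulli_def sum_subtractf diff_divide_distrib)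
  also have "?T n = of_nat n ^ k * (\<Sum>i\<le>k. of_nat (k choose i) * bern i)"
    unfolding sum_distrib_left by (intro sum.cong) (auto simp: mult_ac simp flip: power_add)
  also have "\<dots> / of_nat n = of_nat n ^ (k - 1) * (twisted_bernoulli 1 (\<lambda>_. 1) k :: 'a)"
    using assms by (cases k) (simp_all add: twisted_bernoulli_def)
  finally show ?thesis
    unfolding twisted_bernoulli_const[OF assms(1)] by (simp add: left_diff_distrib)
qed

text \<open>This is the part of the von Staudt--Clausen theorem that bounds denominators. In Faulhaber's
  formula for \<open>\<Sum>a<p. a ^ n\<close> the leading term is \<open>p * bern n\<close>, and all the others are integral by
  induction, because \<open>i + 1\<close> is too small to be divisible by \<open>p ^ (i + 1)\<close>.\<close>

lemma padic_norm_bern_le: "padic_norm (bern n :: 'p::prime_card padic) \<le> real CARD('p)"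
proof (induction n rule: less_induct)
  case (less n)
  let ?p = "CARD('p)"
  note p1 = card_prime_gt_1[where 'p = 'p]
  let ?t = "\<lambda>i. of_nat (n choose i) * (bern (n - i) * of_nat ?p ^ Suc i / of_nat (Suc i)) :: 'p padic"
  have "(\<Sum>a<?p. of_nat a ^ n :: 'p padic) = (\<Sum>i\<le>n. ?t i)"
    by (simp add: sum_powers_bern mult.assoc del: of_nat_Suc power_Suc)
  also have "\<dots> = ?t 0 + (\<Sum>i=1..n. ?t i)"
    by (simp add: atMost_atLeast0 sum.atLeast_Suc_atMost del: of_nat_Suc power_Suc)
  finally have eq: "bern n * of_nat ?p = (\<Sum>a<?p. of_nat a ^ n :: 'p padic) - (\<Sum>i=1..n. ?t i)"
    by simp
  have "padic_norm (?t i) \<le> 1" if i: "i \<in> {1..n}" for i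
  proof (rule padic_norm_mult_le_1)
    have "Suc i < 2 ^ Suc i" by (rule less_exp)
    also have "2 ^ Suc i \<le> ?p ^ Suc i"
      using p1 by (intro power_mono) auto
    finally have "padic_norm (of_nat (Suc i) :: 'p padic) \<ge> 1 / real ?p ^ i"
      by (intro padic_norm_of_nat_ge) auto
    moreover have "padic_norm (bern (n - i) :: 'p padic) \<le> real ?p"
      using i by (intro less.IH) auto
    ultimately have "padic_norm (bern (n - i) * of_nat ?p ^ Suc i / of_nat (Suc i) :: 'p padic)
        \<le> real ?p * (1 / real ?p) ^ Suc i / (1 / real ?p ^ i)"
      using p1 unfolding padic_norm_divide padic_norm_mult padic_norm_power padic_norm_p
      by (intro frac_le mult_right_mono) auto
    also have "\<dots> = 1"
      using p1 by (simp add: field_simps)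
    finally show "padic_norm (bern (n - i) * of_nat ?p ^ Suc i / of_nat (Suc i) :: 'p padic) \<le> 1" .
  qed simp
  then have "padic_norm (\<Sum>i=1..n. ?t i) \<le> 1"
    by (intro padic_norm_sum_le) auto
  moreover have "padic_norm (\<Sum>a<?p. of_nat a ^ n :: 'p padic) \<le> 1"
    by (intro padic_norm_sum_le padic_norm_power_le_1) auto
  ultimately have "padic_norm (bern n * of_nat ?p :: 'p padic) \<le> 1"
    unfolding eq using padic_norm_diff_le[of "\<Sum>a<?p. of_nat a ^ n :: 'p padic" "\<Sum>i=1..n. ?t i"]
    by linarith
  then show ?case
    using p1 by (simp add: padic_norm_mult padic_norm_p field_simps)
qed

lemma padic_norm_bern_power_le:
  "padic_norm (bern i * of_nat CARD('p) ^ i :: 'p::prime_card padic) \<le> real CARD('p) / real CARD('p) ^ i"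
  using mult_right_mono[OF padic_norm_bern_le[of i, where 'p = 'p], of "(1 / real CARD('p)) ^ i"]
  by (simp add: padic_norm_mult padic_norm_power padic_norm_p power_divide)

text \<open>For \<open>i = 1\<close> the general bound only shows integrality. The extra factor \<open>p\<close> comes from
  \<open>B\<^sub>1 = -1/2\<close>, and this is where \<open>p\<close> has to be odd.\<close>

lemma padic_norm_bern_power_le':
  assumes "CARD('p::prime_card) \<noteq> 2" "i > 0"
  shows "padic_norm (bern i * of_nat CARD('p) ^ i :: 'p padic) \<le> 1 / real CARD('p)"
proof (cases "i = 1")
  case True
  have "\<not> CARD('p) dvd 2"
    using assms(1) card_prime_gt_1[where 'p = 'p] by (auto dest: dvd_imp_le)
  then have "padic_norm (of_nat 2 :: 'p padic) = 1"
    by (simp only: padic_norm_of_nat_eq_1_iff) simp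
  then have "padic_norm (2 :: 'p padic) = 1"
    by simp
  then show ?thesis
    using True by (simp add: bern_1 padic_norm_mult padic_norm_divide padic_norm_p)
next
  case False
  with assms have "i \<ge> 2" by simp
  then have "real CARD('p) ^ 2 \<le> real CARD('p) ^ i"
    using card_prime_gt_1[where 'p = 'p] by (intro power_increasing) auto
  then have "real CARD('p) / real CARD('p) ^ i \<le> real CARD('p) / real CARD('p) ^ 2"
    using card_prime_gt_1[where 'p = 'p] by (intro divide_left_mono) auto
  also have "\<dots> = 1 / real CARD('p)"
    by (simp add: power2_eq_square)
  finally show ?thesis
    using padic_norm_bern_power_le[of i, where 'p = 'p] by linarith
qed

section \<open>Powers of the Teichmueller character\<close>

text \<open>A primitive root modulo \<open>p\<close> does it, since the Teichmueller lift determines the residue class.\<close>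

lemma teichmueller_power_nontrivial:
  assumes "\<not> (CARD('p::prime_card) - 1) dvd n"
  obtains c :: nat where "\<not> CARD('p) dvd c" "(teichmueller (int c) :: 'p padic) ^ n \<noteq> 1"
proof -
  let ?p = "CARD('p)"
  have "prime ?p" by (rule prime_card)
  then obtain g where "residue_primroot ?p g"
    using prime_primitive_root_exists card_prime_gt_1[where 'p = 'p] by blast
  then have g: "coprime ?p g" "ord ?p g = ?p - 1"
    using \<open>prime ?p\<close> by (auto simp: residue_primroot_def totient_prime)
  have g': "\<not> ?p dvd g"
    using g(1) card_prime_gt_1[where 'p = 'p] by (auto simp: coprime_absorb_left)
  have "(teichmueller (int g) :: 'p padic) ^ n \<noteq> 1"
  proof
    assume 1: "(teichmueller (int g) :: 'p padic) ^ n = 1"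
    have "padic_norm (teichmueller (int g) ^ n - of_int (int g) ^ n :: 'p padic) \<le> padic_norm (teichmueller (int g) - of_int (int g) :: 'p padic)"
      using g' by (intro padic_norm_power_diff_le) (auto simp: norm_teichmueller)
    also have "\<dots> \<le> 1 / real ?p"
      using g' by (intro teichmueller_close) auto
    also have "\<dots> < 1"
      using card_prime_gt_1[where 'p = 'p] by simp
    finally have "padic_norm (of_int (1 - int g ^ n) :: 'p padic) < 1"
      by (simp add: 1)
    then have "int ?p dvd 1 - int g ^ n"
      using padic_norm_of_int_eq_1[of "1 - int g ^ n", where 'p = 'p] by (cases "int ?p dvd 1 - int g ^ n") simp_all
    then have "[1 = int g ^ n] (mod int ?p)"
      by (simp add: cong_iff_dvd_diff)
    then have "[int (g ^ n) = int 1] (mod int ?p)"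
      by (simp add: cong_sym)
    then have "[g ^ n = 1] (mod ?p)"
      by (simp only: cong_int_iff)
    then have "ord ?p g dvd n"
      by (simp only: ord_divides)
    with g assms show False by simp
  qed
  with g' show ?thesis by (rule that)
qed

text \<open>Orthogonality: if the character is nontrivial at \<open>c\<close>, then multiplication by \<open>c\<close> permutes the
  residue classes and multiplies the sum with a number other than 1.\<close>

lemma sum_teichmueller_power:
  "(\<Sum>a=1..<CARD('p::prime_card). (teichmueller (int a) :: 'p padic) ^ n)
     = (if (CARD('p) - 1) dvd n then of_nat (CARD('p) - 1) else 0)"
proof (cases "(CARD('p) - 1) dvd n")
  case True
  have "(teichmueller (int a) :: 'p padic) ^ n = 1" if "a \<in> {1..<CARD('p)}" for a
    using not_card_dvd_if_less[OF that] True by (intro teichmueller_power_dvd) auto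
  with True show ?thesis by simp
next
  case False
  let ?p = "CARD('p)"
  let ?S = "\<Sum>a=1..<?p. (teichmueller (int a) :: 'p padic) ^ n"
  obtain c where c: "\<not> ?p dvd c" "(teichmueller (int c) :: 'p padic) ^ n \<noteq> 1"
    using False by (rule teichmueller_power_nontrivial)
  define h where "h a = (c * a) mod ?p" for a
  have cop: "coprime c ?p"
    using c(1) prime_card[where 'a = 'p] by (metis coprime_commute prime_imp_coprime)
  have pos: "?p > 0" using card_prime_gt_1[where 'p = 'p] by simp
  have "inj_on h {1..<?p}"
  proof (rule inj_onI)
    fix a b assume ab: "a \<in> {1..<?p}" "b \<in> {1..<?p}" "h a = h b"
    then have "[c * a = c * b] (mod ?p)"
      by (simp add: h_def cong_def)
    then have "[a = b] (mod ?p)"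
      using cop by (simp add: cong_mult_lcancel_nat)
    with ab show "a = b" by (simp add: cong_def)
  qed
  moreover have "h ` {1..<?p} \<subseteq> {1..<?p}"
  proof
    fix b assume "b \<in> h ` {1..<?p}"
    then obtain a where a: "a \<in> {1..<?p}" "b = (c * a) mod ?p" by (auto simp: h_def)
    have "\<not> ?p dvd a" using a by (auto dest: dvd_imp_le)
    then have "\<not> ?p dvd c * a"
      using c(1) prime_card[where 'a = 'p] by (simp add: prime_dvd_mult_iff)
    then have "b > 0" using a by (auto simp: dvd_eq_mod_eq_0)
    then show "b \<in> {1..<?p}" using a pos by simp
  qed
  ultimately have bij: "bij_betw h {1..<?p} {1..<?p}"
    by (simp add: bij_betw_def endo_inj_surj)
  have "(teichmueller (int (h a)) :: 'p padic) = teichmueller (int c) * teichmueller (int a)" for a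
  proof -
    have "int ?p dvd int (h a) - int c * int a"
      by (simp add: h_def of_nat_mod flip: cong_iff_dvd_diff)
    from teichmueller_cong[OF this] show ?thesis
      by (simp add: teichmueller_mult)
  qed
  then have "?S = teichmueller (int c) ^ n * ?S"
    using sum.reindex_bij_betw[OF bij, of "\<lambda>a. (teichmueller (int a) :: 'p padic) ^ n"]
    by (simp add: power_mult_distrib sum_distrib_left)
  then have "(teichmueller (int c) ^ n - 1) * ?S = 0"
    by (simp add: left_diff_distrib)
  with c(2) False show ?thesis by simp
qed

lemma coprime_card_iff: "coprime a (int CARD('p::prime_card)) \<longleftrightarrow> \<not> int CARD('p) dvd a"
proof
  show "coprime a (int CARD('p)) \<Longrightarrow> \<not> int CARD('p) dvd a"
    using card_prime_gt_1[where 'p = 'p] by (auto simp: coprime_absorb_right)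
  show "\<not> int CARD('p) dvd a \<Longrightarrow> coprime a (int CARD('p))"
    using prime_card_int[where 'a = 'p] by (metis coprime_commute prime_imp_coprime)
qed

lemma dirichlet_char_teichmueller_power:
  assumes "n > 0"
  shows "dirichlet_char CARD('p) (\<lambda>a. inverse (teichmueller a :: 'p::prime_card padic) ^ n)"
proof -
  have "(teichmueller (a + int CARD('p)) :: 'p padic) = teichmueller a" for a
    by (rule teichmueller_cong) simp
  then show ?thesis
    using assms card_prime_gt_1[where 'p = 'p]
    by (auto simp: dirichlet_char_def teichmueller_mult power_mult_distrib
        coprime_card_iff teichmueller_eq_0_iff)
qed

lemma dirichlet_char_cong:
  assumes chi: "dirichlet_char n chi" and "[a = b] (mod int n)"
  shows "chi a = chi b"
proof -
  have step: "chi (a + int n) = chi a" for a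
    using chi by (simp add: dirichlet_char_def)
  have "chi (a + int n * k) = chi a" for k
  proof (induction k rule: int_induct[of _ 0])
    case (step1 k)
    then show ?case using step[of "a + int n * k"] by (simp add: algebra_simps)
  next
    case (step2 k)
    then show ?case using step[of "a + int n * (k - 1)"] by (simp add: algebra_simps)
  qed simp
  moreover obtain k where "b = a + int n * k"
    using assms(2) by (auto simp: cong_iff_lin)
  ultimately show ?thesis by simp
qed

lemma dirichlet_char_at_1:
  assumes "dirichlet_char n chi"
  shows "chi 1 = 1"
proof -
  have "chi (1 * 1) = chi 1 * chi 1" "chi 1 \<noteq> 0"
    using assms unfolding dirichlet_char_def by (blast, simp)
  then show ?thesis by simp
qed

lemma dirichlet_char_1_iff: "dirichlet_char 1 chi \<longleftrightarrow> chi = (\<lambda>_. 1)"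
proof
  assume d: "dirichlet_char 1 chi"
  have "chi a = 1" for a
    using dirichlet_char_cong[OF d, of a 1] dirichlet_char_at_1[OF d] by simp
  then show "chi = (\<lambda>_. 1)" by auto
qed (simp add: dirichlet_char_def)

text \<open>This applies to \<open>\<omega> ^ n\<close> if \<open>p - 1\<close> divides \<open>n\<close>: its values are 0 and 1, but the primitive character
  is 1 also on the multiples of \<open>p\<close>.\<close>

lemma
  assumes triv: "\<And>a. chi a \<noteq> 0 \<Longrightarrow> chi a = (1 :: 'a::field)"
  shows conductor_trivial: "conductor chi = 1"
    and primitive_char_trivial: "primitive_char chi = (\<lambda>_. 1)"
proof -
  show c: "conductor chi = 1"
    unfolding conductor_def
  proof (rule Least_equality)
    show "\<exists>\<psi>. dirichlet_char 1 \<psi> \<and> (\<forall>a. chi a \<noteq> 0 \<longrightarrow> \<psi> a = chi a)"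
      unfolding dirichlet_char_1_iff using triv by auto
    show "1 \<le> f" if "\<exists>\<psi> :: int \<Rightarrow> 'a. dirichlet_char f \<psi> \<and> (\<forall>a. chi a \<noteq> 0 \<longrightarrow> \<psi> a = chi a)" for f
      using that by (auto simp: dirichlet_char_def)
  qed
  show "primitive_char chi = (\<lambda>_. 1)"
    unfolding primitive_char_def c dirichlet_char_1_iff
    by (rule the_equality) (use triv in auto)
qed

text \<open>A nontrivial character modulo a prime is primitive. If it were induced from a modulus \<open>f < p\<close>,
  then, by the Chinese remainder theorem, some \<open>b\<close> would be congruent to 1 modulo \<open>p\<close> and to \<open>c\<close>
  modulo \<open>f\<close>, and the value at \<open>b\<close> would be both 1 and the value at \<open>c\<close>.\<close>

lemma
  fixes chi :: "int \<Rightarrow> 'a::field"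
  assumes p: "prime p" and chi: "dirichlet_char p chi" and c: "chi c \<noteq> 0" "chi c \<noteq> 1"
  shows conductor_prime: "conductor chi = p"
    and primitive_char_prime: "primitive_char chi = chi"
proof -
  show cond: "conductor chi = p"
    unfolding conductor_def
  proof (rule Least_equality)
    show "\<exists>\<psi>. dirichlet_char p \<psi> \<and> (\<forall>a. chi a \<noteq> 0 \<longrightarrow> \<psi> a = chi a)"
      using chi by blast
    fix f assume "\<exists>\<psi> :: int \<Rightarrow> 'a. dirichlet_char f \<psi> \<and> (\<forall>a. chi a \<noteq> 0 \<longrightarrow> \<psi> a = chi a)"
    then obtain \<psi> :: "int \<Rightarrow> 'a" where \<psi>: "dirichlet_char f \<psi>" "\<And>a. chi a \<noteq> 0 \<Longrightarrow> \<psi> a = chi a"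
      by blast
    show "p \<le> f"
    proof (rule ccontr)
      assume "\<not> p \<le> f"
      moreover have "f > 0" using \<psi> by (simp add: dirichlet_char_def)
      ultimately have "coprime (int p) (int f)"
        using p by (metis dvd_imp_le coprime_int_iff prime_imp_coprime)
      then obtain b where b: "[b = 1] (mod int p)" "[b = c] (mod int f)"
        using binary_chinese_remainder_int by blast
      have "\<psi> b = \<psi> c"
        using \<psi>(1) b(2) by (rule dirichlet_char_cong)
      moreover have "chi b = 1"
        using dirichlet_char_cong[OF chi b(1)] dirichlet_char_at_1[OF chi] by simp
      ultimately show False
        using \<psi>(2)[of b] \<psi>(2)[of c] c by simp
    qed
  qed
  show "primitive_char chi = chi"
    unfolding primitive_char_def cond
  proof (rule the_equality)
    show "dirichlet_char p chi \<and> (\<forall>a. chi a \<noteq> 0 \<longrightarrow> chi a = chi a)"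
      using chi by simp
    fix \<psi> :: "int \<Rightarrow> 'a" assume "dirichlet_char p \<psi> \<and> (\<forall>a. chi a \<noteq> 0 \<longrightarrow> \<psi> a = chi a)"
    with chi show "\<psi> = chi"
      unfolding dirichlet_char_def fun_eq_iff by metis
  qed
qed

lemma twisted_bernoulli_cong:
  "(\<And>a. a \<in> {1..n} \<Longrightarrow> u a = v a) \<Longrightarrow> twisted_bernoulli n u k = twisted_bernoulli n v k"
  by (simp add: twisted_bernoulli_def)

text \<open>The interpolated values do not need a case distinction between trivial and nontrivial
  characters: if \<open>\<omega> ^ n\<close> is trivial, then the conductor is 1 and the Euler factor takes out the
  multiples of \<open>p\<close>; otherwise the conductor is \<open>p\<close>, the Euler factor is 1, and the character
  vanishes on the multiples of \<open>p\<close> by itself.\<close>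

lemma euler_factor_times_gen_bernoulli:
  fixes n k :: nat
  assumes "n > 0" "k > 0"
  defines "psi \<equiv> primitive_char (\<lambda>a. inverse (teichmueller a :: 'p::prime_card padic) ^ n)"
  shows "(1 - psi (int CARD('p)) * of_nat CARD('p) ^ (k - 1)) * gen_bernoulli k psi
       = twisted_bernoulli CARD('p) (\<lambda>a. inverse (teichmueller (int a)) ^ n) k"
proof (cases "(CARD('p) - 1) dvd n")
  case True
  have one: "inverse (teichmueller a :: 'p padic) ^ n = 1" if "\<not> int CARD('p) dvd a" for a
    using True that by (simp add: power_inverse teichmueller_power_dvd)
  have psi: "psi = (\<lambda>_. 1)"
    unfolding psi_def using assms(1) one
    by (intro primitive_char_trivial) (auto simp: teichmueller_eq_0_iff)
  have "conductor (\<lambda>_. 1 :: 'p padic) = 1"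
    by (rule conductor_trivial) simp
  then have "gen_bernoulli k psi = twisted_bernoulli 1 (\<lambda>_. 1) k"
    by (simp add: psi gen_bernoulli_eq_twisted_bernoulli)
  then have "(1 - psi (int CARD('p)) * of_nat CARD('p) ^ (k - 1)) * gen_bernoulli k psi
      = twisted_bernoulli CARD('p) (\<lambda>a. if a = CARD('p) then 0 else 1) k"
    using assms(2) card_prime_gt_1[where 'p = 'p]
    by (subst twisted_bernoulli_principal) (auto simp: psi)
  also have "\<dots> = twisted_bernoulli CARD('p) (\<lambda>a. inverse (teichmueller (int a)) ^ n) k"
  proof (rule twisted_bernoulli_cong)
    fix a assume "a \<in> {1..CARD('p)}"
    then have "CARD('p) dvd a \<longleftrightarrow> a = CARD('p)"
      by (auto dest: dvd_imp_le)
    then show "(if a = CARD('p) then 0 else 1) = inverse (teichmueller (int a) :: 'p padic) ^ n"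
      using assms(1) one[of "int a"] by (auto simp: teichmueller_dvd)
  qed
  finally show ?thesis .
next
  case False
  obtain c where c: "\<not> CARD('p) dvd c" "(teichmueller (int c) :: 'p padic) ^ n \<noteq> 1"
    using False by (rule teichmueller_power_nontrivial)
  let ?chi = "\<lambda>a. inverse (teichmueller a :: 'p padic) ^ n"
  have *: "dirichlet_char CARD('p) ?chi" "?chi (int c) \<noteq> 0" "?chi (int c) \<noteq> 1"
    using dirichlet_char_teichmueller_power[OF assms(1), where 'p = 'p] c
    by (auto simp: teichmueller_eq_0_iff power_inverse)
  have psi: "psi = ?chi" and cond: "conductor ?chi = CARD('p)"
    unfolding psi_def
    by (rule primitive_char_prime[OF prime_card *] conductor_prime[OF prime_card *])+
  show ?thesis
    using assms(1) cond card_prime_gt_1[where 'p = 'p]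
    by (simp add: psi gen_bernoulli_eq_twisted_bernoulli teichmueller_dvd)
qed

section \<open>Density of the positive integers in the p-adic integers\<close>

text \<open>The denominator of \<open>r\<close> is prime to \<open>p\<close> and therefore invertible modulo \<open>p ^ M\<close>. The summand
  \<open>p ^ M\<close> in the witness only makes it positive.\<close>

lemma rat_int_approx:
  assumes p: "prime p" and r: "rat_padic_norm p r \<le> 1"
  shows "\<exists>N::nat>0. rat_padic_norm p (r - of_nat N) \<le> 1 / real p ^ M"
proof -
  obtain a b where ab: "quotient_of r = (a, b)" by (cases "quotient_of r")
  have b: "b > 0" "r = of_int a / of_int b" "coprime a b"
    using ab quotient_of_denom_pos quotient_of_div quotient_of_coprime by blast+
  have p1: "p > 1" using p prime_gt_1_nat by blast
  have pb: "\<not> int p dvd b"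
  proof
    assume dvd: "int p dvd b"
    have "\<not> int p dvd a"
    proof
      assume "int p dvd a"
      with dvd b(3) have "is_unit (int p)" by (meson coprime_common_divisor)
      with p1 show False by simp
    qed
    then have "a \<noteq> 0" "multiplicity (int p) a = 0"
      by (auto intro: not_dvd_imp_multiplicity_0)
    moreover have "multiplicity (int p) b > 0"
      using dvd b(1) p1 by (subst multiplicity_gt_zero_iff) auto
    ultimately have "rat_padic_norm p r = real p ^ multiplicity (int p) b" "multiplicity (int p) b > 0"
      using b rat_padic_norm_frac[OF p, of a b] by auto
    moreover have "real p ^ multiplicity (int p) b > 1"
      using p1 \<open>multiplicity (int p) b > 0\<close> by (intro one_less_power) auto
    ultimately show False using r by simp
  qed
  then have "coprime b (int p ^ M)"
    using p by (metis coprime_commute coprime_power_right_iff prime_imp_coprime prime_nat_int_transfer)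
  then obtain x where x: "[b * x = 1] (mod int p ^ M)"
    using cong_solve_coprime_int by blast
  define N where "N = nat ((a * x) mod int p ^ M) + p ^ M"
  have pM: "int p ^ M > 0" using p1 by simp
  have N: "int N = (a * x) mod int p ^ M + int p ^ M"
    using pM by (simp add: N_def)
  have "[b * int N = b * (a * x)] (mod int p ^ M)"
    unfolding N by (intro cong_mult cong_refl) (simp add: cong_def)
  also have "b * (a * x) = a * (b * x)" by simp
  also have "[a * (b * x) = a * 1] (mod int p ^ M)"
    by (intro cong_mult cong_refl x)
  finally have dvd: "int p ^ M dvd a - b * int N"
    by (simp add: cong_iff_dvd_diff dvd_diff_commute)
  have "rat_padic_norm p (r - of_nat N) \<le> 1 / real p ^ M"
  proof (cases "a - b * int N = 0")
    case True
    then have "a = b * int N" by simp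
    then have "r - of_nat N = 0"
      using b(1) by (simp add: b(2))
    then show ?thesis by (simp only: rat_padic_norm_0) simp
  next
    case False
    have "r - of_nat N = of_int (a - b * int N) / of_int b"
      using b(1) by (simp add: b(2) diff_divide_distrib)
    moreover have "multiplicity (int p) b = 0"
      using pb by (rule not_dvd_imp_multiplicity_0)
    moreover have "multiplicity (int p) (a - b * int N) \<ge> M"
      using dvd False p1 by (intro multiplicity_geI) auto
    ultimately have "rat_padic_norm p (r - of_nat N) \<le> real p powi (- int M)"
      using rat_padic_norm_frac[OF p False, of b] b(1) p1
      by (auto intro!: power_int_increasing)
    then show ?thesis
      by (simp add: power_int_minus divide_inverse)
  qed
  moreover have "N > 0" using p1 by (simp add: N_def)
  ultimately show ?thesis by blast
qed

lemma padic_integers_dense: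
  fixes x :: "'p::prime_card padic"
  assumes "x \<in> padic_integers" "e > 0"
  shows "\<exists>N::nat>0. padic_norm (x - of_nat N) < e"
proof -
  obtain r where r: "padic_norm (x - of_rat r) < min e 1"
    using assms(2) by (elim padic_rat_dense[of "min e 1", rotated]) auto
  have "padic_norm (of_rat r :: 'p padic) \<le> 1"
  proof -
    have "padic_norm x \<le> 1" "padic_norm (x - of_rat r) \<le> 1"
      using r assms(1) by (simp_all add: padic_integers_def)
    then show ?thesis
      using padic_norm_diff_le[of x "x - of_rat r"] by simp
  qed
  then have r1: "qnorm TYPE('p) r \<le> 1"
    by (simp add: norm_of_rat_padic)
  obtain M where M: "1 / real CARD('p) ^ M < e"
    using padic_arch[OF assms(2)] by blast
  obtain N :: nat where N: "N > 0" "qnorm TYPE('p) (r - of_nat N) \<le> 1 / real CARD('p) ^ M"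
    using rat_int_approx[OF prime_card r1] by blast
  have "padic_norm (of_rat (r - of_nat N) :: 'p padic) < e"
    using N M by (simp only: norm_of_rat_padic)
  then have "padic_norm ((x - of_rat r) + of_rat (r - of_nat N)) < e"
    using padic_norm_add[of "x - of_rat r" "of_rat (r - of_nat N)"] r by linarith
  then show ?thesis
    using N(1) by (intro exI[of _ N]) (simp add: of_rat_diff)
qed

lemma padic_integers_subset_closure:
  "padic_integers \<subseteq> closure (of_nat ` {1..} :: 'p::prime_card padic set)"
proof
  fix x :: "'p padic" assume x: "x \<in> padic_integers"
  show "x \<in> closure (of_nat ` {1..})"
    unfolding closure_approachable
  proof (intro allI impI)
    fix e :: real assume "e > 0"
    from padic_integers_dense[OF x this] obtain N :: nat where "N > 0" "padic_norm (x - of_nat N) < e"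
      by blast
    then show "\<exists>y\<in>of_nat ` {1..}. dist y x < e"
      by (intro bexI[of _ "of_nat N"]) (auto simp: dist_padic_def padic_norm_diff_commute)
  qed
qed

section \<open>Functions of an exponent that are p-adically Lipschitz\<close>

text \<open>The exponent varies over the natural numbers with their \<open>p\<close>-adic distance. Boundedness
  is included in order that products of such functions are again of this kind.\<close>

definition padic_lipschitz :: "(nat \<Rightarrow> 'p::prime_card padic) \<Rightarrow> bool" where
  "padic_lipschitz f \<longleftrightarrow> (\<exists>C. \<forall>i j. padic_norm (f i) \<le> C \<and>
     padic_norm (f i - f j) \<le> C * padic_norm (of_nat i - of_nat j :: 'p padic))"

lemma padic_lipschitzE:
  fixes f :: "nat \<Rightarrow> 'p::prime_card padic"
  assumes "padic_lipschitz f"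
  obtains C where "C \<ge> 0" "\<And>i. padic_norm (f i) \<le> C"
    "\<And>i j. padic_norm (f i - f j) \<le> C * padic_norm (of_nat i - of_nat j :: 'p padic)"
proof -
  from assms obtain C where C: "\<forall>i j. padic_norm (f i) \<le> C \<and>
     padic_norm (f i - f j) \<le> C * padic_norm (of_nat i - of_nat j :: 'p padic)"
    unfolding padic_lipschitz_def by blast
  then have "C \<ge> 0" using padic_norm_ge_0[of "f 0"] by (meson order.trans)
  with C show ?thesis by (intro that) auto
qed

lemma padic_lipschitz_const [intro]: "padic_lipschitz (\<lambda>_. c)"
  unfolding padic_lipschitz_def by (intro exI[of _ "padic_norm c"]) auto

lemma padic_lipschitz_of_nat [intro]: "padic_lipschitz of_nat"
  unfolding padic_lipschitz_def by (intro exI[of _ 1]) auto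

lemma padic_lipschitz_add [intro]:
  fixes f g :: "nat \<Rightarrow> 'p::prime_card padic"
  assumes "padic_lipschitz f" "padic_lipschitz g"
  shows "padic_lipschitz (\<lambda>i. f i + g i)"
proof -
  obtain C where C: "C \<ge> 0" "\<And>i. padic_norm (f i) \<le> C"
    "\<And>i j. padic_norm (f i - f j) \<le> C * padic_norm (of_nat i - of_nat j :: 'p padic)"
    using assms(1) by (rule padic_lipschitzE) blast
  obtain D where D: "D \<ge> 0" "\<And>i. padic_norm (g i) \<le> D"
    "\<And>i j. padic_norm (g i - g j) \<le> D * padic_norm (of_nat i - of_nat j :: 'p padic)"
    using assms(2) by (rule padic_lipschitzE) blast
  show ?thesis
    unfolding padic_lipschitz_def
  proof (intro exI[of _ "C + D"] allI conjI)
    fix i j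
    show "padic_norm (f i + g i) \<le> C + D"
      using C(1) C(2)[of i] D(1) D(2)[of i] by (intro padic_norm_add_le) auto
    let ?n = "padic_norm (of_nat i - of_nat j :: 'p padic)"
    have "C * ?n \<le> (C + D) * ?n" "D * ?n \<le> (C + D) * ?n"
      using C(1) D(1) by (auto intro!: mult_right_mono)
    then have "padic_norm ((f i - f j) + (g i - g j)) \<le> (C + D) * ?n"
      using C(3)[of i j] D(3)[of i j] by (intro padic_norm_add_le) auto
    then show "padic_norm (f i + g i - (f j + g j)) \<le> (C + D) * ?n"
      by (simp add: algebra_simps)
  qed
qed

lemma padic_lipschitz_mult [intro]:
  fixes f g :: "nat \<Rightarrow> 'p::prime_card padic"
  assumes "padic_lipschitz f" "padic_lipschitz g"
  shows "padic_lipschitz (\<lambda>i. f i * g i)"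
proof -
  obtain C where C: "C \<ge> 0" "\<And>i. padic_norm (f i) \<le> C"
    "\<And>i j. padic_norm (f i - f j) \<le> C * padic_norm (of_nat i - of_nat j :: 'p padic)"
    using assms(1) by (rule padic_lipschitzE) blast
  obtain D where D: "D \<ge> 0" "\<And>i. padic_norm (g i) \<le> D"
    "\<And>i j. padic_norm (g i - g j) \<le> D * padic_norm (of_nat i - of_nat j :: 'p padic)"
    using assms(2) by (rule padic_lipschitzE) blast
  show ?thesis
    unfolding padic_lipschitz_def
  proof (intro exI[of _ "C * D"] allI conjI)
    fix i j
    show "padic_norm (f i * g i) \<le> C * D"
      unfolding padic_norm_mult using C(1) C(2)[of i] D(2)[of i] by (intro mult_mono) auto
    let ?n = "padic_norm (of_nat i - of_nat j :: 'p padic)"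
    have "padic_norm (f i * (g i - g j)) \<le> C * (D * ?n)"
      unfolding padic_norm_mult using C(1) C(2)[of i] D(3)[of i j] by (intro mult_mono) auto
    moreover have "padic_norm ((f i - f j) * g j) \<le> (C * ?n) * D"
      unfolding padic_norm_mult using C(1) C(3)[of i j] D(2)[of j] by (intro mult_mono) auto
    ultimately have "padic_norm (f i * (g i - g j) + (f i - f j) * g j) \<le> C * D * ?n"
      by (intro padic_norm_add_le) (simp_all add: mult_ac)
    then show "padic_norm (f i * g i - f j * g j) \<le> C * D * ?n"
      by (simp add: algebra_simps)
  qed
qed

lemma padic_lipschitz_sum [intro]:
  assumes "\<And>a. a \<in> A \<Longrightarrow> padic_lipschitz (f a)"
  shows "padic_lipschitz (\<lambda>i. \<Sum>a\<in>A. f a i)"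
  using assms by (induction A rule: infinite_finite_induct) auto

lemma padic_lipschitz_prod [intro]:
  assumes "\<And>a. a \<in> A \<Longrightarrow> padic_lipschitz (f a)"
  shows "padic_lipschitz (\<lambda>i. \<Prod>a\<in>A. f a i)"
  using assms by (induction A rule: infinite_finite_induct) auto

text \<open>Binomial coefficients with fixed lower entry are polynomials in the upper one.\<close>

lemma padic_lipschitz_binomial [intro]:
  "padic_lipschitz (\<lambda>j. of_nat (j choose i) :: 'p::prime_card padic)"
proof -
  have eq: "(of_nat (j choose i) :: 'p padic) = (\<Prod>l=0..<i. of_nat j + (- of_nat l)) * inverse (fact i)" for j
    by (simp add: binomial_gbinomial gbinomial_prod_rev divide_inverse)
  show ?thesis
    unfolding eq
    by (intro padic_lipschitz_mult padic_lipschitz_prod padic_lipschitz_add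
        padic_lipschitz_of_nat padic_lipschitz_const)
qed

lemma padic_lipschitz_power [intro]:
  fixes x :: "'p::prime_card padic"
  assumes "padic_norm (x - 1) \<le> 1 / real CARD('p)"
  shows "padic_lipschitz (\<lambda>j. x ^ j)"
proof -
  have le1: "padic_norm (x - 1) \<le> 1"
    using assms inverse_power_card_le_1[of 1, where 'p = 'p] by (simp only: power_one_right order.trans)
  then have x: "padic_norm x \<le> 1"
    using padic_norm_add_le[OF le1, of 1] by simp
  have le: "padic_norm (x ^ i - x ^ j) \<le> padic_norm (of_nat i - of_nat j :: 'p padic)" if "j \<le> i" for i j
  proof -
    have "x ^ i - x ^ j = x ^ j * (x ^ (i - j) - 1)"
      using that by (simp add: right_diff_distrib flip: power_add)
    also have "padic_norm \<dots> \<le> padic_norm (x ^ (i - j) - 1)"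
      by (intro padic_norm_mult_le_1 padic_norm_power_le_1 x) simp
    also have "\<dots> \<le> padic_norm (of_nat (i - j) :: 'p padic) * padic_norm (x - 1)"
      by (rule padic_norm_one_unit_power[OF assms])
    also have "\<dots> \<le> padic_norm (of_nat (i - j) :: 'p padic) * 1"
      by (intro mult_left_mono le1) simp
    finally show ?thesis using that by (simp add: of_nat_diff)
  qed
  show ?thesis
    unfolding padic_lipschitz_def
  proof (intro exI[of _ 1] allI conjI)
    fix i j
    show "padic_norm (x ^ i) \<le> 1" by (rule padic_norm_power_le_1[OF x])
    show "padic_norm (x ^ i - x ^ j) \<le> 1 * padic_norm (of_nat i - of_nat j :: 'p padic)"
      using le[of i j] le[of j i] by (cases "j \<le> i") (auto simp: padic_norm_diff_commute)
  qed
qed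

section \<open>Washington's formula\<close>

text \<open>With \<open>\<langle>a\<rangle> = a / \<omega>(a)\<close> the following is Washington's formula
  \<open>(1/p) \<Sum>\<^sub>a \<omega>(a)^{-K} \<langle>a\<rangle>^j \<Sum>\<^sub>i (j choose i) B\<^sub>i (p/a)^i\<close> with the inner sum cut off after \<open>i = n\<close>.
  It depends on \<open>j\<close> only through \<open>\<langle>a\<rangle>^j\<close> and the binomial coefficients, both of which make
  sense for \<open>p\<close>-adic \<open>j\<close>.\<close>

definition washington_partial :: "nat \<Rightarrow> nat \<Rightarrow> nat \<Rightarrow> 'p::prime_card padic" where
  "washington_partial K n j =
     (\<Sum>a=1..<CARD('p). inverse (teichmueller (int a)) ^ K * (of_nat a / teichmueller (int a)) ^ j *
        (\<Sum>i\<le>n. of_nat (j choose i) * (bern i * of_nat CARD('p) ^ i) * inverse (of_nat a) ^ i)) / of_nat CARD('p)"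

text \<open>The number \<open>- j * L (1 - j)\<close> for the \<open>p\<close>-adic \<open>L\<close>-function of \<open>\<omega>^{-K}\<close>.\<close>

definition washington :: "nat \<Rightarrow> nat \<Rightarrow> 'p::prime_card padic" where
  "washington K j = twisted_bernoulli CARD('p) (\<lambda>a. inverse (teichmueller (int a)) ^ (K + j)) j"

text \<open>The twist by \<open>\<omega>^{-j}\<close> in the interpolation condition combines with the powers of \<open>a\<close> in the
  Bernoulli polynomial to \<open>\<langle>a\<rangle>^j * a^{-i}\<close>. Cutting off beyond \<open>j\<close> has no effect since the binomial
  coefficients vanish there; this allows a cutoff that does not depend on \<open>j\<close>.\<close>

lemma washington_eq_partial:
  assumes "K > 0" "j \<le> n"
  shows "(washington K j :: 'p::prime_card padic) = washington_partial K n j"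
proof -
  let ?p = "CARD('p)"
  let ?u = "\<lambda>a. inverse (teichmueller (int a) :: 'p padic)"
  let ?T = "\<lambda>a. (\<Sum>i\<le>j. of_nat (j choose i) * bern i * of_nat ?p ^ i * of_nat a ^ (j - i)) :: 'p padic"
  have "{1..?p} = insert ?p {1..<?p}"
    using card_prime_gt_1[where 'p = 'p] by auto
  then have "(\<Sum>a=1..?p. ?u a ^ (K + j) * ?T a) = (\<Sum>a=1..<?p. ?u a ^ (K + j) * ?T a)"
    using assms(1) by (simp add: teichmueller_dvd)
  also have "\<dots> = (\<Sum>a=1..<?p. ?u a ^ K * (of_nat a / teichmueller (int a)) ^ j *
        (\<Sum>i\<le>n. of_nat (j choose i) * (bern i * of_nat ?p ^ i) * inverse (of_nat a) ^ i))"
  proof (rule sum.cong)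
    fix a assume a: "a \<in> {1..<?p}"
    have "(\<Sum>i\<le>n. of_nat (j choose i) * (bern i * of_nat ?p ^ i) * inverse (of_nat a) ^ i)
        = (\<Sum>i\<le>j. of_nat (j choose i) * (bern i * of_nat ?p ^ i) * inverse (of_nat a :: 'p padic) ^ i)"
      using assms(2) by (intro sum.mono_neutral_right) auto
    moreover have "of_nat a ^ j * (\<Sum>i\<le>j. of_nat (j choose i) * (bern i * of_nat ?p ^ i) * inverse (of_nat a) ^ i)
        = (\<Sum>i\<le>j. of_nat (j choose i) * (bern i * of_nat ?p ^ i) * (of_nat a ^ (j - i) :: 'p padic))"
      unfolding sum_distrib_left
    proof (rule sum.cong)
      fix i assume "i \<in> {..j}"
      then have pow: "of_nat a ^ j * inverse (of_nat a) ^ i = (of_nat a ^ (j - i) :: 'p padic)"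
        using a by (simp add: power_inverse power_diff divide_inverse)
      show "of_nat a ^ j * (of_nat (j choose i) * (bern i * of_nat ?p ^ i) * inverse (of_nat a) ^ i)
          = of_nat (j choose i) * (bern i * of_nat ?p ^ i) * (of_nat a ^ (j - i) :: 'p padic)"
        unfolding pow[symmetric] by (rule mult.left_commute)
    qed simp
    ultimately have "of_nat a ^ j * (\<Sum>i\<le>n. of_nat (j choose i) * (bern i * of_nat ?p ^ i) * inverse (of_nat a) ^ i)
        = (\<Sum>i\<le>j. of_nat (j choose i) * (bern i * of_nat ?p ^ i) * (of_nat a ^ (j - i) :: 'p padic))"
      by simp
    also have "\<dots> = ?T a" by (simp add: mult.assoc)
    finally have T: "?T a = of_nat a ^ j * (\<Sum>i\<le>n. of_nat (j choose i) * (bern i * of_nat ?p ^ i) * inverse (of_nat a) ^ i)"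
      by simp
    show "?u a ^ (K + j) * ?T a = ?u a ^ K * (of_nat a / teichmueller (int a)) ^ j *
        (\<Sum>i\<le>n. of_nat (j choose i) * (bern i * of_nat ?p ^ i) * inverse (of_nat a) ^ i)"
      unfolding T by (simp add: power_add divide_inverse power_mult_distrib mult_ac)
  qed simp
  finally show ?thesis
    by (simp add: washington_def twisted_bernoulli_def washington_partial_def)
qed

text \<open>All other factors are integral, so only the numbers \<open>B\<^sub>i * p ^ i\<close> and the division by \<open>p\<close> matter.
  The bound is uniform in \<open>j\<close>.\<close>

lemma padic_norm_washington_partial_diff:
  assumes "n \<le> m" "B \<ge> 0"
    and B: "\<And>i. n < i \<Longrightarrow> padic_norm (bern i * of_nat CARD('p) ^ i :: 'p::prime_card padic) \<le> B"
  shows "padic_norm (washington_partial K m j - washington_partial K n j :: 'p padic) \<le> real CARD('p) * B"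
proof -
  let ?p = "CARD('p)"
  let ?c = "\<lambda>i. of_nat (j choose i) * (bern i * of_nat ?p ^ i) :: 'p padic"
  let ?v = "\<lambda>a. inverse (teichmueller (int a)) ^ K * (of_nat a / teichmueller (int a)) ^ j :: 'p padic"
  have split: "(\<Sum>i\<le>m. ?c i * inverse (of_nat a) ^ i) - (\<Sum>i\<le>n. ?c i * inverse (of_nat a) ^ i)
      = (\<Sum>i\<in>{n<..m}. ?c i * inverse (of_nat a) ^ i)" for a
  proof -
    have "{..m} - {..n} = {n<..m}" by auto
    with assms(1) show ?thesis
      using sum_diff[of "{..m}" "{..n}" "\<lambda>i. ?c i * inverse (of_nat a) ^ i"] by simp
  qed
  have "padic_norm (\<Sum>a=1..<?p. ?v a * (\<Sum>i\<in>{n<..m}. ?c i * inverse (of_nat a) ^ i)) \<le> B"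
  proof (rule padic_norm_sum_le[OF _ \<open>B \<ge> 0\<close>])
    fix a assume a: "a \<in> {1..<?p}"
    have ndvd: "\<not> ?p dvd a" using a by (rule not_card_dvd_if_less)
    then have na: "padic_norm (of_nat a :: 'p padic) = 1"
      by (simp add: padic_norm_of_nat_eq_1_iff)
    have nt: "padic_norm (teichmueller (int a) :: 'p padic) = 1"
      using ndvd by (simp add: norm_teichmueller)
    have v: "padic_norm (?v a) \<le> 1"
      by (simp add: padic_norm_mult padic_norm_power padic_norm_inverse padic_norm_divide nt na)
    show "padic_norm (?v a * (\<Sum>i\<in>{n<..m}. ?c i * inverse (of_nat a) ^ i)) \<le> B"
    proof (rule padic_norm_mult_le_1[OF v], rule padic_norm_sum_le[OF _ \<open>B \<ge> 0\<close>])
      fix i assume "i \<in> {n<..m}"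
      then have "padic_norm (bern i * of_nat ?p ^ i :: 'p padic) \<le> B"
        by (intro B) auto
      then have "padic_norm (?c i) \<le> B"
        by (rule padic_norm_mult_le_1[OF padic_norm_of_nat_le_1])
      then show "padic_norm (?c i * inverse (of_nat a) ^ i) \<le> B"
        by (simp add: padic_norm_mult padic_norm_power padic_norm_inverse na)
    qed
  qed
  moreover have "washington_partial K m j - washington_partial K n j
      = (\<Sum>a=1..<?p. ?v a * (\<Sum>i\<in>{n<..m}. ?c i * inverse (of_nat a) ^ i)) / of_nat ?p"
    unfolding washington_partial_def split[symmetric]
    by (simp add: diff_divide_distrib sum_subtractf right_diff_distrib)
  ultimately show ?thesis
    by (simp add: padic_norm_divide padic_norm_p mult.commute mult_left_mono)
qed

lemma padic_norm_angle:
  assumes "a \<in> {1..<CARD('p)}"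
  shows "padic_norm (of_nat a / teichmueller (int a) - 1 :: 'p::prime_card padic) \<le> 1 / real CARD('p)"
proof -
  have a: "\<not> int CARD('p) dvd int a"
    using not_card_dvd_if_less[OF assms] by simp
  have t: "padic_norm (teichmueller (int a) :: 'p padic) = 1"
    using a by (rule norm_teichmueller)
  then have "teichmueller (int a) \<noteq> (0 :: 'p padic)"
    by (metis padic_norm_0 zero_neq_one)
  then have "of_nat a / teichmueller (int a) - 1 = (of_nat a - teichmueller (int a)) / (teichmueller (int a) :: 'p padic)"
    by (simp add: diff_divide_distrib)
  then show ?thesis
    using teichmueller_close[OF a] t by (simp add: padic_norm_divide padic_norm_diff_commute)
qed

lemma padic_lipschitz_washington_partial:
  "padic_lipschitz (washington_partial K n :: nat \<Rightarrow> 'p::prime_card padic)"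
  unfolding washington_partial_def divide_inverse[of _ "of_nat CARD('p)"]
  by (intro padic_lipschitz_mult padic_lipschitz_sum padic_lipschitz_const
      padic_lipschitz_binomial padic_lipschitz_power padic_norm_angle)

text \<open>A uniform limit of Lipschitz functions.\<close>

lemma washington_uniformly_continuous:
  assumes "K > 0" "e > 0"
  shows "\<exists>d>0. \<forall>i j. padic_norm (of_nat i - of_nat j :: 'p::prime_card padic) < d \<longrightarrow>
           padic_norm (washington K i - washington K j :: 'p padic) < e"
proof -
  let ?p = "CARD('p)"
  let ?W = "washington K :: nat \<Rightarrow> 'p padic"
  note p1 = card_prime_gt_1[where 'p = 'p]
  obtain n where n: "real ?p * real ?p / real ?p ^ n < e"
    using padic_arch[OF assms(2)] by blast
  let ?V = "washington_partial K n :: nat \<Rightarrow> 'p padic"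
  have close: "padic_norm (?W j - ?V j) < e" for j
  proof -
    have "padic_norm (washington_partial K (max j n) j - ?V j) \<le> real ?p * (real ?p / real ?p ^ n)"
    proof (rule padic_norm_washington_partial_diff)
      fix i assume "n < i"
      then have "real ?p / real ?p ^ i \<le> real ?p / real ?p ^ n"
        using p1 by (intro divide_left_mono power_increasing) auto
      with padic_norm_bern_power_le[of i, where 'p = 'p]
      show "padic_norm (bern i * of_nat ?p ^ i :: 'p padic) \<le> real ?p / real ?p ^ n" by linarith
    qed auto
    also have "washington_partial K (max j n) j = ?W j"
      using assms(1) by (intro washington_eq_partial[symmetric]) auto
    finally show ?thesis using n by simp
  qed
  obtain C where C: "C \<ge> 0" "\<And>i j. padic_norm (?V i - ?V j) \<le> C * padic_norm (of_nat i - of_nat j :: 'p padic)"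
    using padic_lipschitz_washington_partial[of K n, where 'p = 'p] by (rule padic_lipschitzE) blast
  show ?thesis
  proof (intro exI[of _ "e / (C + 1)"] conjI allI impI)
    show "e / (C + 1) > 0" using assms(2) C(1) by simp
    fix i j assume ij: "padic_norm (of_nat i - of_nat j :: 'p padic) < e / (C + 1)"
    have "padic_norm (?V i - ?V j) \<le> (C + 1) * padic_norm (of_nat i - of_nat j :: 'p padic)"
      unfolding distrib_right mult_1
      using C(2)[of i j] padic_norm_ge_0[of "of_nat i - of_nat j :: 'p padic"] by linarith
    also have "\<dots> < e"
      using ij C(1) by (simp add: field_simps)
    finally have V: "padic_norm (?V i - ?V j) < e" .
    have "?W i - ?W j = (?W i - ?V i) + ((?V i - ?V j) - (?W j - ?V j))" by simp
    also have "padic_norm \<dots> < e"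
      using padic_norm_add[of "?W i - ?V i" "(?V i - ?V j) - (?W j - ?V j)"]
        padic_norm_diff_le[of "?V i - ?V j" "?W j - ?V j"] close[of i] close[of j] V by linarith
    finally show "padic_norm (?W i - ?W j) < e" .
  qed
qed

lemma padic_norm_sum_powers:
  defines "S \<equiv> (\<lambda>j. \<Sum>a=1..<CARD('p::prime_card). of_nat a ^ j :: 'p padic)"
  shows "(CARD('p) - 1) dvd j \<Longrightarrow> padic_norm (S j) = 1"
    and "\<not> (CARD('p) - 1) dvd j \<Longrightarrow> padic_norm (S j) \<le> 1 / real CARD('p)"
proof -
  let ?p = "CARD('p)"
  let ?T = "\<Sum>a=1..<?p. teichmueller (int a) ^ j :: 'p padic"
  have close: "padic_norm (S j - ?T) \<le> 1 / real ?p"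
    unfolding S_def sum_subtractf[symmetric]
  proof (rule padic_norm_sum_le)
    fix a assume a: "a \<in> {1..<?p}"
    have "\<not> int ?p dvd int a"
      using not_card_dvd_if_less[OF a] by simp
    from norm_teichmueller[OF this] teichmueller_close[OF this]
    show "padic_norm (of_nat a ^ j - teichmueller (int a) ^ j :: 'p padic) \<le> 1 / real ?p"
      using padic_norm_power_diff_le[of "of_nat a" "teichmueller (int a) :: 'p padic" j]
      by (simp add: padic_norm_diff_commute)
  qed simp
  show "padic_norm (S j) \<le> 1 / real ?p" if "\<not> (?p - 1) dvd j"
    using close unfolding sum_teichmueller_power using that by simp
  show "padic_norm (S j) = 1" if "(?p - 1) dvd j"
  proof -
    have "\<not> ?p dvd ?p - 1"
      using card_prime_gt_1[where 'p = 'p] by (intro not_card_dvd_if_less) auto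
    then have "padic_norm (of_nat (?p - 1) :: 'p padic) = 1"
      by (simp only: padic_norm_of_nat_eq_1_iff) simp
    then have T: "padic_norm ?T = 1"
      using that by (simp only: sum_teichmueller_power if_True)
    have "1 / real ?p < 1"
      using card_prime_gt_1[where 'p = 'p] by simp
    then have "padic_norm (S j - ?T) < padic_norm ?T"
      using close T by linarith
    from padic_norm_eq_if_close[OF this] T show ?thesis by simp
  qed
qed

text \<open>If \<open>p - 1\<close> divides \<open>K + j\<close>, then \<open>\<omega>(a)^{-K} \<langle>a\<rangle>^j = a ^ j\<close>. All terms with \<open>i > 0\<close> in Washington's
  formula together are integral, and what remains is \<open>(1/p) * (\<Sum>a=1..<p. a ^ j)\<close>.\<close>

lemma padic_norm_washington:
  assumes "CARD('p::prime_card) \<noteq> 2" "K > 0" "(CARD('p) - 1) dvd K + j"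
  shows "(CARD('p) - 1) dvd j \<Longrightarrow> padic_norm (washington K j :: 'p padic) = real CARD('p)"
    and "\<not> (CARD('p) - 1) dvd j \<Longrightarrow> padic_norm (washington K j :: 'p padic) \<le> 1"
proof -
  let ?p = "CARD('p)"
  note p1 = card_prime_gt_1[where 'p = 'p]
  let ?W = "washington K j :: 'p padic"
  let ?V = "washington_partial K 0 j :: 'p padic"
  have "padic_norm (washington_partial K j j - ?V) \<le> real ?p * (1 / real ?p)"
    using padic_norm_bern_power_le'[OF assms(1)] by (intro padic_norm_washington_partial_diff) auto
  then have close: "padic_norm (?W - ?V) \<le> 1"
    using assms(2) p1 by (simp add: washington_eq_partial[of K j j])
  have "inverse (teichmueller (int a)) ^ K * (of_nat a / teichmueller (int a)) ^ j = (of_nat a ^ j :: 'p padic)"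
    if a: "a \<in> {1..<?p}" for a
  proof -
    have "\<not> int ?p dvd int a"
      using not_card_dvd_if_less[OF a] by simp
    then have "inverse (teichmueller (int a) :: 'p padic) ^ (K + j) = 1"
      using assms(3) by (simp add: power_inverse teichmueller_power_dvd)
    then show ?thesis
      by (simp add: divide_inverse power_mult_distrib power_add mult_ac)
  qed
  then have "?V = (\<Sum>a=1..<?p. of_nat a ^ j) / of_nat ?p"
    by (simp add: washington_partial_def)
  then have V: "padic_norm ?V = real ?p * padic_norm (\<Sum>a=1..<?p. of_nat a ^ j :: 'p padic)"
    by (simp add: padic_norm_divide padic_norm_p mult.commute)
  show "padic_norm ?W = real ?p" if "(?p - 1) dvd j"
  proof -
    have "padic_norm ?V = real ?p"
      unfolding V using padic_norm_sum_powers(1)[OF that] by simp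
    moreover from this have "padic_norm (?W - ?V) < padic_norm ?V"
      using close p1 by simp
    ultimately show ?thesis
      using padic_norm_eq_if_close by metis
  qed
  show "padic_norm ?W \<le> 1" if "\<not> (?p - 1) dvd j"
  proof -
    have "padic_norm ?V \<le> real ?p * (1 / real ?p)"
      unfolding V using padic_norm_sum_powers(2)[OF that] by (intro mult_left_mono) auto
    then have "padic_norm ?V \<le> 1" by simp
    from padic_norm_add_le[OF close this] show ?thesis by simp
  qed
qed

section \<open>Existence and uniqueness of the p-adic L-function\<close>

lemma
  assumes "is_padic_L chi L"
  shows is_padic_L_continuous: "continuous_on (padic_integers - {1}) L"
    and is_padic_L_outside: "s \<notin> padic_integers - {1} \<Longrightarrow> L s = 0"
proof -
  have "continuous_on (padic_integers - {1}) L \<and> (\<forall>s. s \<notin> padic_integers - {1} \<longrightarrow> L s = 0)"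
    using assms unfolding is_padic_L_def by (elim conjE) (intro conjI)
  then show "continuous_on (padic_integers - {1}) L" "s \<notin> padic_integers - {1} \<Longrightarrow> L s = 0"
    by simp_all
qed

text \<open>The points \<open>1 - k\<close> are dense in the \<open>p\<close>-adic integers.\<close>

lemma is_padic_L_unique:
  fixes chi :: "int \<Rightarrow> 'p::prime_card padic"
  assumes "is_padic_L chi L" "is_padic_L chi L'"
  shows "L = L'"
proof
  fix s :: "'p padic"
  let ?D = "padic_integers - {1 :: 'p padic}"
  show "L s = L' s"
  proof (cases "s \<in> ?D")
    case True
    have "1 - s \<in> padic_integers"
      using True padic_norm_diff_le[of 1 s] by (auto simp: padic_integers_def)
    then have "1 - s \<in> closure (of_nat ` {1..})"
      using padic_integers_subset_closure by blast
    then obtain x where x: "\<And>n. x n \<in> of_nat ` {1..}" "x \<longlonglongrightarrow> 1 - s"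
      unfolding closure_sequential by blast
    then have "\<forall>n. \<exists>k::nat\<ge>1. x n = of_nat k" by force
    then obtain k where k: "\<And>n. k n \<ge> (1::nat)" "\<And>n. x n = of_nat (k n)" by metis
    define y where "y n = 1 - x n" for n
    have y: "y \<longlonglongrightarrow> s"
    proof (rule metric_LIMSEQ_I)
      fix e :: real assume "e > 0"
      then obtain N where "\<And>n. n \<ge> N \<Longrightarrow> dist (x n) (1 - s) < e"
        using metric_LIMSEQ_D[OF x(2)] by blast
      moreover have "dist (y n) s = dist (x n) (1 - s)" for n
        unfolding dist_padic_def y_def by (subst padic_norm_diff_commute) (simp add: algebra_simps)
      ultimately show "\<exists>N. \<forall>n\<ge>N. dist (y n) s < e" by auto
    qed
    have yD: "y n \<in> ?D" for n
      using k[of n] padic_norm_diff_le[of 1 "of_nat (k n) :: 'p padic"]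
      by (auto simp: y_def padic_integers_def order.trans)
    have lim: "(\<lambda>n. F (y n)) \<longlonglongrightarrow> F s" if "continuous_on ?D F" for F :: "'p padic \<Rightarrow> 'p padic"
      using that True y yD by (auto simp: continuous_on_sequentially o_def)
    define psi where "psi k = primitive_char (\<lambda>a. chi a * inverse (teichmueller a) ^ k)" for k
    define v where "v k = - (1 - psi k (int CARD('p)) * of_nat CARD('p) ^ (k - 1)) * gen_bernoulli k (psi k) / of_nat k" for k
    have interp: "F (1 - of_nat k) = v k" if "is_padic_L chi F" "k \<ge> 1" for F and k :: nat
      using that unfolding is_padic_L_def Let_def v_def psi_def by blast
    have "L (y n) = L' (y n)" for n
      unfolding y_def k(2) using interp[OF assms(1) k(1)[of n]] interp[OF assms(2) k(1)[of n]] by simp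
    with lim[OF is_padic_L_continuous[OF assms(2)]] have "(\<lambda>n. L (y n)) \<longlonglongrightarrow> L' s"
      by simp
    with lim[OF is_padic_L_continuous[OF assms(1)]] show ?thesis
      by (rule LIMSEQ_unique)
  next
    case False
    then show ?thesis
      using assms[THEN is_padic_L_outside] by simp
  qed
qed

lemma continuous_on_padic_divide:
  fixes f g :: "'a::topological_space \<Rightarrow> 'p::prime_card padic"
  assumes "continuous_on S f" "continuous_on S g" "\<And>x. x \<in> S \<Longrightarrow> g x \<noteq> 0"
  shows "continuous_on S (\<lambda>x. f x / g x)"
  unfolding continuous_on_def
proof
  fix x assume x: "x \<in> S"
  let ?F = "at x within S"
  have f: "(f \<longlongrightarrow> f x) ?F" and g: "(g \<longlongrightarrow> g x) ?F"
    using assms x by (auto simp: continuous_on_def)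
  have gx: "padic_norm (g x) > 0"
    using assms(3)[OF x] by (rule padic_norm_pos)
  show "((\<lambda>x. f x / g x) \<longlongrightarrow> f x / g x) ?F"
  proof (rule tendstoI)
    fix e :: real assume e: "e > 0"
    define C where "C = padic_norm (f x) + padic_norm (g x)"
    have C: "C > 0" unfolding C_def using gx by (simp add: add_nonneg_pos)
    define d where "d = min (padic_norm (g x)) (e * padic_norm (g x) ^ 2 / C)"
    have "e * padic_norm (g x) ^ 2 / C > 0"
      using e gx C by (intro divide_pos_pos mult_pos_pos zero_less_power)
    with gx have d: "d > 0" by (simp add: d_def)
    have "\<forall>\<^sub>F y in ?F. dist (f y) (f x) < d" "\<forall>\<^sub>F y in ?F. dist (g y) (g x) < d"
      using f g d by (auto dest: tendstoD)
    then show "\<forall>\<^sub>F y in ?F. dist (f y / g y) (f x / g x) < e"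
    proof eventually_elim
      case (elim y)
      have gy: "padic_norm (g y) = padic_norm (g x)"
        using elim(2) by (intro padic_norm_eq_if_close) (simp add: dist_padic_def d_def)
      have nz: "g y \<noteq> 0" "g x \<noteq> 0" using gy gx by auto
      have "f y / g y - f x / g x = ((f y - f x) * g x - f x * (g y - g x)) / (g y * g x)"
        using nz by (simp add: field_simps)
      then have eq: "dist (f y / g y) (f x / g x) = padic_norm ((f y - f x) * g x - f x * (g y - g x)) / padic_norm (g x) ^ 2"
        by (simp add: dist_padic_def padic_norm_divide padic_norm_mult gy power2_eq_square)
      have "padic_norm ((f y - f x) * g x - f x * (g y - g x)) < d * C"
      proof -
        have "padic_norm ((f y - f x) * g x - f x * (g y - g x))
            \<le> padic_norm (f y - f x) * padic_norm (g x) + padic_norm (f x) * padic_norm (g y - g x)"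
          using padic_norm_diff_le[of "(f y - f x) * g x" "f x * (g y - g x)"]
            padic_norm_ge_0[of "(f y - f x) * g x"] padic_norm_ge_0[of "f x * (g y - g x)"]
          unfolding padic_norm_mult by linarith
        also have "\<dots> < d * padic_norm (g x) + padic_norm (f x) * d"
          using elim gx
          by (intro add_less_le_mono mult_strict_right_mono mult_left_mono) (auto simp: dist_padic_def)
        finally show ?thesis by (simp add: C_def algebra_simps)
      qed
      also have "d * C \<le> e * padic_norm (g x) ^ 2"
        using C unfolding d_def by (simp add: min_le_iff_disj pos_le_divide_eq[symmetric])
      finally show ?case
        unfolding eq using nz by (subst pos_divide_less_eq) simp_all
    qed
  qed
qed

text \<open>A uniformly continuous function extends to the closure of its domain, and the positive integers
  are dense in the \<open>p\<close>-adic integers.\<close>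

lemma washington_interpolation:
  assumes "K > 0"
  obtains g :: "'p::prime_card padic \<Rightarrow> 'p padic"
  where "continuous_on padic_integers g" "\<And>j::nat. j \<ge> 1 \<Longrightarrow> g (of_nat j) = washington K j"
proof -
  let ?X = "of_nat ` {1..} :: 'p padic set"
  let ?f = "\<lambda>x :: 'p padic. washington K (inv_into UNIV of_nat x) :: 'p padic"
  have inv: "inv_into UNIV of_nat (of_nat j :: 'p padic) = j" for j
    by (rule inv_f_f) (rule inj_of_nat)
  have "uniformly_continuous_on ?X ?f"
    unfolding uniformly_continuous_on_def
  proof (intro allI impI)
    fix e :: real assume "e > 0"
    then obtain d where "d > 0" "\<And>i j. padic_norm (of_nat i - of_nat j :: 'p padic) < d \<Longrightarrow>
           padic_norm (washington K i - washington K j :: 'p padic) < e"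
      using washington_uniformly_continuous[OF assms, where 'p = 'p] by metis
    then show "\<exists>d>0. \<forall>x\<in>?X. \<forall>x'\<in>?X. dist x' x < d \<longrightarrow> dist (?f x') (?f x) < e"
      by (intro exI[of _ d]) (auto simp: dist_padic_def inv)
  qed
  then obtain g where g: "uniformly_continuous_on (closure ?X) g" "\<And>x. x \<in> ?X \<Longrightarrow> ?f x = g x"
    by (rule uniformly_continuous_on_extension_on_closure) blast
  show ?thesis
  proof
    show "continuous_on padic_integers g"
      using uniformly_continuous_imp_continuous[OF g(1)] padic_integers_subset_closure continuous_on_subset by blast
    show "g (of_nat j) = washington K j" if "j \<ge> 1" for j :: nat
      using g(2)[of "of_nat j"] that by (simp add: inv)
  qed
qed

lemma is_padic_L_divide:
  fixes g :: "'p::prime_card padic \<Rightarrow> 'p padic"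
  assumes g: "continuous_on padic_integers g" "\<And>j::nat. j \<ge> 1 \<Longrightarrow> g (of_nat j) = washington K j"
    and K: "K > 0"
  shows "is_padic_L (\<lambda>a. inverse (teichmueller a) ^ K)
     (\<lambda>s. if s \<in> padic_integers - {1} then g (1 - s) / (s - 1) else 0)" (is "is_padic_L _ ?L")
  unfolding is_padic_L_def Let_def
proof (intro conjI allI impI)
  let ?D = "padic_integers - {1 :: 'p padic}"
  have iso: "continuous_on ?D (\<lambda>s. 1 - s :: 'p padic)" "continuous_on ?D (\<lambda>s. s - 1 :: 'p padic)"
    unfolding continuous_on_iff by (auto simp: dist_padic_def padic_norm_diff_commute)
  have "continuous_on ?D (\<lambda>s. g (1 - s))"
  proof (rule continuous_on_compose2[OF g(1) iso(1)])
    show "(-) 1 ` ?D \<subseteq> padic_integers"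
    proof
      fix x assume "x \<in> (-) 1 ` ?D"
      then obtain s where s: "x = 1 - s" "s \<in> padic_integers" by auto
      with padic_norm_diff_le[of 1 s] show "x \<in> padic_integers"
        by (simp add: padic_integers_def)
    qed
  qed
  then have "continuous_on ?D (\<lambda>s. g (1 - s) / (s - 1))"
    by (intro continuous_on_padic_divide iso) auto
  then show "continuous_on ?D ?L"
    by (subst continuous_on_cong[OF refl]) auto
  show "?L s = 0" if "s \<notin> ?D" for s using that by auto
  fix k :: nat assume k: "k \<ge> 1"
  have "(1 - of_nat k :: 'p padic) \<in> ?D"
    using k padic_norm_diff_le[of 1 "of_nat k :: 'p padic"] padic_norm_of_nat_le_1[of k, where 'p = 'p]
    by (auto simp: padic_integers_def)
  then have "?L (1 - of_nat k) = - washington K k / of_nat k"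
    using g(2)[OF k] by simp
  moreover have chi: "(\<lambda>a. inverse (teichmueller a :: 'p padic) ^ K * inverse (teichmueller a) ^ k)
      = (\<lambda>a. inverse (teichmueller a) ^ (K + k))"
    by (simp add: power_add)
  ultimately show "?L (1 - of_nat k) =
      - (1 - primitive_char (\<lambda>a. inverse (teichmueller a) ^ K * inverse (teichmueller a) ^ k) (int CARD('p)) *
          of_nat CARD('p) ^ (k - 1)) *
        gen_bernoulli k (primitive_char (\<lambda>a. inverse (teichmueller a) ^ K * inverse (teichmueller a) ^ k)) / of_nat k"
    using euler_factor_times_gen_bernoulli[of "K + k" k, where 'p = 'p] k
    by (simp only: chi mult_minus_left washington_def)
qed

section \<open>Values at integers greater than 1\<close>

text \<open>The value at \<open>1 + m\<close> is \<open>g (- m) / m\<close> for the extension \<open>g\<close> of Washington's function. As \<open>- m\<close> is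
  not a natural number, \<open>g (- m)\<close> is compared with the value at a natural number close to it which
  moreover lies in the class of \<open>- m\<close> modulo \<open>p - 1\<close>, where the character drops out.\<close>

lemma padic_norm_padic_L:
  fixes m :: nat
  assumes p: "CARD('p::prime_card) \<noteq> 2" and m: "m > 0"
  defines "L \<equiv> padic_L (1 + of_nat m) (\<lambda>a. inverse (teichmueller a :: 'p padic) ^ m)"
  shows "(CARD('p) - 1) dvd m \<Longrightarrow> padic_norm L = real CARD('p) / padic_norm (of_nat m :: 'p padic)"
    and "\<not> (CARD('p) - 1) dvd m \<Longrightarrow> padic_norm L \<le> 1 / padic_norm (of_nat m :: 'p padic)"
proof -
  let ?p = "CARD('p)"
  note p1 = card_prime_gt_1[where 'p = 'p]
  obtain g :: "'p padic \<Rightarrow> 'p padic" where g: "continuous_on padic_integers g"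
      "\<And>j::nat. j \<ge> 1 \<Longrightarrow> g (of_nat j) = washington m j"
    using washington_interpolation[OF m] by metis
  let ?x = "- of_nat m :: 'p padic"
  have "(THE L. is_padic_L (\<lambda>a. inverse (teichmueller a :: 'p padic) ^ m) L)
      = (\<lambda>s. if s \<in> padic_integers - {1} then g (1 - s) / (s - 1) else 0)"
    using is_padic_L_divide[OF g m] is_padic_L_unique by (intro the_equality) auto
  moreover have "(1 + of_nat m :: 'p padic) \<in> padic_integers - {1}"
    using m padic_norm_of_nat_le_1[of "Suc m", where 'p = 'p] by (auto simp: padic_integers_def)
  ultimately have "L = g ?x / of_nat m"
    unfolding L_def padic_L_def Let_def using m by simp
  then have L: "padic_norm L = padic_norm (g ?x) / padic_norm (of_nat m :: 'p padic)"
    by (simp add: padic_norm_divide)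
  have x: "?x \<in> padic_integers"
    by (simp add: padic_integers_def)
  then obtain d where d: "d > 0" "\<And>y. y \<in> padic_integers \<Longrightarrow> dist y ?x < d \<Longrightarrow> dist (g y) (g ?x) < 1"
    using g(1) zero_less_one unfolding continuous_on_iff by metis
  obtain M where M: "1 / real ?p ^ M < d"
    using padic_arch[OF d(1)] by blast
  \<comment> \<open>This is \<open>- m\<close> both modulo \<open>p ^ Suc M\<close> and modulo \<open>p - 1\<close>.\<close>
  define j where "j = m * (?p ^ Suc M * (?p - 1) - 1)"
  have big: "?p ^ Suc M * (?p - 1) \<ge> 2"
  proof -
    have "?p ^ Suc M \<ge> ?p ^ 1" using p1 by (intro power_increasing) auto
    moreover have "?p - 1 \<ge> 1" using p1 by simp
    ultimately have "?p ^ 1 * 1 \<le> ?p ^ Suc M * (?p - 1)" by (rule mult_le_mono)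
    then have "?p \<le> ?p ^ Suc M * (?p - 1)" by (simp only: power_one_right mult_1_right)
    with p1 show ?thesis by linarith
  qed
  have mj: "m + j = m * (?p ^ Suc M * (?p - 1))"
  proof -
    have "m + m * (X - 1) = m * X" if "X \<ge> 2" for X :: nat
      using that by (cases X) simp_all
    from this[OF big] show ?thesis by (simp only: j_def)
  qed
  have dvd: "(?p - 1) dvd m + j" unfolding mj by simp
  have j1: "j \<ge> 1" using big m by (simp add: j_def)
  have "dist (of_nat j) ?x = padic_norm (of_nat (m + j) :: 'p padic)"
    by (simp add: dist_padic_def add.commute)
  also have "\<dots> \<le> 1 / real ?p ^ M"
    unfolding mj by (intro padic_norm_of_nat_dvd) (simp add: dvd_mult dvd_mult2)
  also note M
  finally have "dist (g (of_nat j)) (g ?x) < 1"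
    by (intro d(2)) (auto simp: padic_integers_def)
  then have close: "padic_norm (g ?x - washington m j) < 1"
    using g(2)[OF j1] by (simp add: dist_padic_def padic_norm_diff_commute)
  have dvd_iff: "(?p - 1) dvd m \<longleftrightarrow> (?p - 1) dvd j"
    using dvd by (metis dvd_add_left_iff dvd_add_right_iff)
  show "padic_norm L = real ?p / padic_norm (of_nat m :: 'p padic)" if "(?p - 1) dvd m"
  proof -
    have W: "padic_norm (washington m j :: 'p padic) = real ?p"
      using that dvd_iff by (intro padic_norm_washington(1)[OF p m dvd]) auto
    then have "padic_norm (g ?x) = real ?p"
      using padic_norm_eq_if_close[of "g ?x" "washington m j"] close p1 by simp
    with L show ?thesis by simp
  qed
  show "padic_norm L \<le> 1 / padic_norm (of_nat m :: 'p padic)" if "\<not> (?p - 1) dvd m"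
  proof -
    have W: "padic_norm (washington m j :: 'p padic) \<le> 1"
      using that dvd_iff by (intro padic_norm_washington(2)[OF p m dvd]) auto
    then have "padic_norm (g ?x) \<le> 1"
      using padic_norm_add[of "g ?x - washington m j" "washington m j"] close by simp
    with L show ?thesis by (simp add: divide_right_mono)
  qed
qed

text \<open>The interpolation conditions of the trivial character and of the principal character modulo \<open>p\<close>
  are the same, because both characters only enter after multiplication with a positive power
  of \<open>\<omega>^{-1}\<close>, which vanishes on the multiples of \<open>p\<close>.\<close>

lemma padic_zeta_eq_padic_L:
  assumes "n > 0" "(CARD('p::prime_card) - 1) dvd n"
  shows "padic_zeta s = padic_L s (\<lambda>a. inverse (teichmueller a :: 'p padic) ^ n)"
proof -
  have *: "inverse (teichmueller a :: 'p padic) ^ n * inverse (teichmueller a) ^ k = 1 * inverse (teichmueller a) ^ k"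
    if "k \<ge> 1" for a and k :: nat
  proof (cases "int CARD('p) dvd a")
    case True
    with that show ?thesis by (simp add: teichmueller_dvd)
  next
    case False
    with assms(2) show ?thesis by (simp add: power_inverse teichmueller_power_dvd)
  qed
  have "is_padic_L (\<lambda>a. inverse (teichmueller a :: 'p padic) ^ n) = is_padic_L (\<lambda>_. 1)"
    unfolding is_padic_L_def
    by (rule ext, rule conj_cong[OF refl], rule conj_cong[OF refl], rule all_cong1,
        rule imp_cong[OF refl], simp only: *)
  then show ?thesis by (simp add: padic_zeta_def padic_L_def)
qed

lemma padic_val_eq:
  assumes "padic_norm x = real CARD('p) ^ n"
  shows "padic_val (x :: 'p::prime_card padic) = - ereal (real n)"
proof -
  have "x \<noteq> 0"
    using assms card_prime_gt_1[where 'p = 'p] by auto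
  moreover have "log (real CARD('p)) (real CARD('p) ^ n) = real n"
    using card_prime_gt_1[where 'p = 'p] by (simp add: log_nat_power)
  ultimately show ?thesis
    by (simp add: padic_val_def assms)
qed

lemma padic_val_ge:
  assumes "padic_norm x \<le> real CARD('p) ^ n"
  shows "padic_val (x :: 'p::prime_card padic) \<ge> - ereal (real n)"
proof (cases "x = 0")
  case False
  then have pos: "padic_norm x > 0"
    by (rule padic_norm_pos)
  have "log (real CARD('p)) (padic_norm x) \<le> log (real CARD('p)) (real CARD('p) ^ n)"
    using card_prime_gt_1[where 'p = 'p] pos assms by (intro log_mono) auto
  also have "\<dots> = real n"
    using card_prime_gt_1[where 'p = 'p] by (simp add: log_nat_power)
  finally show ?thesis
    using False by (simp add: padic_val_def)
qed (simp add: padic_val_def)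

text \<open>If \<open>p - 1\<close> divides \<open>m\<close>, the pole of the zeta function costs a factor \<open>p\<close>; but then \<open>m / (p - 1)\<close>
  is less than \<open>p ^ n\<close>, so that \<open>m\<close> is divisible by \<open>p\<close> at most \<open>n - 1\<close> times instead of \<open>n\<close> times.\<close>

lemma padic_norm_padic_L_le:
  fixes m n :: nat
  assumes p: "CARD('p::prime_card) \<noteq> 2" and m: "m > 0" "m < CARD('p) ^ n * (CARD('p) - 1)"
  shows "padic_norm (padic_L (1 + of_nat m) (\<lambda>a. inverse (teichmueller a :: 'p padic) ^ m)) \<le> real CARD('p) ^ n"
proof -
  let ?p = "CARD('p)"
  note p1 = card_prime_gt_1[where 'p = 'p]
  have pos: "padic_norm (of_nat m :: 'p padic) > 0"
    using m(1) by (intro padic_norm_pos) simp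
  show ?thesis
  proof (cases "(?p - 1) dvd m")
    case True
    then obtain c where c: "m = (?p - 1) * c" by blast
    have c0: "c > 0" "c < ?p ^ n" using m c p1 by auto
    then have "n > 0" by (cases n) auto
    then obtain n' where n': "n = Suc n'" by (cases n) auto
    have "\<not> ?p dvd ?p - 1"
      using p1 by (intro not_card_dvd_if_less) auto
    then have "padic_norm (of_nat (?p - 1) :: 'p padic) = 1"
      by (simp only: padic_norm_of_nat_eq_1_iff) simp
    then have "padic_norm (of_nat m :: 'p padic) = padic_norm (of_nat c :: 'p padic)"
      by (simp only: c of_nat_mult padic_norm_mult mult_1)
    also have "\<dots> \<ge> 1 / real ?p ^ n'"
      using c0 n' by (intro padic_norm_of_nat_ge) auto
    finally have "real ?p / padic_norm (of_nat m :: 'p padic) \<le> real ?p / (1 / real ?p ^ n')"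
      using p1 pos by (intro divide_left_mono mult_pos_pos) auto
    then show ?thesis
      using padic_norm_padic_L(1)[OF p m(1) True] n' by simp
  next
    case False
    have "m < ?p ^ Suc n"
    proof -
      have "?p ^ n * (?p - 1) \<le> ?p ^ n * ?p" by (intro mult_left_mono) auto
      with m(2) have "m < ?p ^ n * ?p" by linarith
      then show ?thesis by (simp add: mult.commute)
    qed
    then have "padic_norm (of_nat m :: 'p padic) \<ge> 1 / real ?p ^ n"
      using m(1) by (intro padic_norm_of_nat_ge)
    then have "1 / padic_norm (of_nat m :: 'p padic) \<le> 1 / (1 / real ?p ^ n)"
      using p1 pos by (intro divide_left_mono mult_pos_pos) auto
    then show ?thesis
      using padic_norm_padic_L(2)[OF p m(1) False] by simp
  qed
qed

theorem corollary7p3p1: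
  fixes p :: nat
  assumes "CARD('p::prime_card) = p" and "p \<noteq> 2"
  shows
    "(\<forall>n::nat\<ge>1. let k = p ^ (n - 1) * (p - 1) in
        padic_val (padic_L (1 + of_nat k) (\<lambda>a. inverse (teichmueller a :: 'p padic) ^ k))
          = padic_val (padic_zeta (1 + of_nat k) :: 'p padic) \<and>
        padic_val (padic_zeta (1 + of_nat k) :: 'p padic) = - ereal (real n)) \<and>
     (\<forall>m::nat\<ge>1.
        (2 * m \<le> p - 2 \<longrightarrow>
           padic_val (padic_L (1 + of_nat (2 * m))
             (\<lambda>a. inverse (teichmueller a :: 'p padic) ^ (2 * m))) \<ge> 0) \<and>
        (\<forall>n::nat\<ge>1. p ^ (n - 1) * (p - 1) \<le> 2 * m \<and> 2 * m < p ^ n * (p - 1) \<longrightarrow>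
           padic_val (padic_L (1 + of_nat (2 * m))
             (\<lambda>a. inverse (teichmueller a :: 'p padic) ^ (2 * m))) \<ge> - ereal (real n)))"
proof -
  have p: "p = CARD('p)" "CARD('p) \<noteq> 2"
    using assms by auto
  have p1: "p > 1"
    using card_prime_gt_1[where 'p = 'p] p by simp
  have lower: "padic_val (padic_L (1 + of_nat m) (\<lambda>a. inverse (teichmueller a :: 'p padic) ^ m)) \<ge> - ereal (real n)"
    if "m > 0" "m < p ^ n * (p - 1)" for m n :: nat
    using that p by (intro padic_val_ge padic_norm_padic_L_le) auto
  have first: "padic_val (padic_L (1 + of_nat k) (\<lambda>a. inverse (teichmueller a :: 'p padic) ^ k)) = - ereal (real n)"
    and zeta: "padic_zeta (1 + of_nat k) = padic_L (1 + of_nat k) (\<lambda>a. inverse (teichmueller a :: 'p padic) ^ k)"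
    if "n \<ge> 1" "k = p ^ (n - 1) * (p - 1)" for n k :: nat
  proof -
    have k: "k > 0" "(p - 1) dvd k" using that p1 by auto
    show "padic_zeta (1 + of_nat k) = padic_L (1 + of_nat k) (\<lambda>a. inverse (teichmueller a :: 'p padic) ^ k)"
      using k p by (intro padic_zeta_eq_padic_L) auto
    have "\<not> p dvd p - 1"
      using p1 p(1) by (simp add: not_card_dvd_if_less)
    then have "padic_norm (of_nat (p - 1) :: 'p padic) = 1"
      unfolding p(1) by (simp only: padic_norm_of_nat_eq_1_iff) simp
    then have "padic_norm (of_nat k :: 'p padic) = (1 / real p) ^ (n - 1)"
      unfolding that(2) of_nat_mult padic_norm_mult of_nat_power padic_norm_power
      by (simp only: p(1) padic_norm_p mult_1_right)
    then have "padic_norm (padic_L (1 + of_nat k) (\<lambda>a. inverse (teichmueller a :: 'p padic) ^ k)) = real p * real p ^ (n - 1)"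
      using padic_norm_padic_L(1)[OF p(2) k(1)] k(2) p(1) by (simp add: power_divide)
    also have "\<dots> = real CARD('p) ^ n"
      using that(1) p(1) by (simp flip: power_Suc)
    finally show "padic_val (padic_L (1 + of_nat k) (\<lambda>a. inverse (teichmueller a :: 'p padic) ^ k)) = - ereal (real n)"
      by (rule padic_val_eq)
  qed
  show ?thesis
  proof (intro conjI allI impI)
    show "let k = p ^ (n - 1) * (p - 1) in
        padic_val (padic_L (1 + of_nat k) (\<lambda>a. inverse (teichmueller a :: 'p padic) ^ k))
          = padic_val (padic_zeta (1 + of_nat k) :: 'p padic) \<and>
        padic_val (padic_zeta (1 + of_nat k) :: 'p padic) = - ereal (real n)" if "1 \<le> n" for n :: nat
      using first[OF that refl] zeta[OF that refl] by (simp add: Let_def)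
    fix m :: nat assume m: "1 \<le> m"
    show "0 \<le> padic_val (padic_L (1 + of_nat (2 * m)) (\<lambda>a. inverse (teichmueller a :: 'p padic) ^ (2 * m)))"
      if "2 * m \<le> p - 2"
      using lower[of "2 * m" 0] m that by (simp flip: zero_ereal_def)
    show "- ereal (real n) \<le> padic_val (padic_L (1 + of_nat (2 * m)) (\<lambda>a. inverse (teichmueller a :: 'p padic) ^ (2 * m)))"
      if "p ^ (n - 1) * (p - 1) \<le> 2 * m \<and> 2 * m < p ^ n * (p - 1)" for n
      using lower[of "2 * m" n] m that by simp
  qed
qed

end
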